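(* Let $\mathbb{F}$ be a field of odd characteristic $p$, and let $q=p^{n_2}$ and $r=p^{n_1}$, where $n_1,n_2>0$ are integers. Let $H=H(2;(n_1,n_2);\Phi(1))$ be the $qr$-dimensional Lie algebra over $\mathbb{F}$ described in the context, with $\bar y=y^{(q-1)}$, and put $$X=x\qquad\text{and}\qquad Y=\bar y .$$ Then: (1) $X$ and $Y$ generate $H$ as a Lie algebra, and a grading of $H$ over $\mathbb{Z}/(q-1)r\mathbb{Z}$ is defined by declaring $X$ and $Y$ to have degree one. (2) $X$ and $Y$ are part of a graded basis of $H$ given by the monomials $x^{(i)}y^{(j)}$ ($0\le i<r$, $0\le j<q$), where $x^{(i)}y^{(j)}$ has degree $(1-q)i-j+q$ modulo $(q-1)r$. (3) The loop algebra $N$ of $H$ with respect to this grading is a thin Lie algebra with second diamond in degree $q$. (4) The diamonds of $N$ occur in all degrees congruent to $1$ modulo $q-1$ (and in no other degree). The diamonds after the first one have all type $\infty$, except those in degrees congruent to $q$ modulo $(q-1)r$, which have type $-1$.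
   Context: Conventions: iterated Lie brackets are left-normed, $[a,b,c]=[[a,b],c]$. The Lie algebra $H(2;(n_1,n_2);\Phi(1))$. Let $\mathbb{F}$ be a field of characteristic $p>0$ and $n_1,n_2$ positive integers. The divided power algebra $\mathcal{O}(2;(n_1,n_2))$ is the commutative associative $\mathbb{F}$-algebra with basis the monomials $x^{(i)}y^{(j)}$, $0\le i<p^{n_1}$, $0\le j<p^{n_2}$, and multiplication $x^{(i)}y^{(j)}\cdot x^{(k)}y^{(l)}=\binom{i+k}{i}\binom{j+l}{j}x^{(i+k)}y^{(j+l)}$, where the right-hand side is zero if $i+k\ge p^{n_1}$ or $j+l\ge p^{n_2}$. Here $x^{(0)}=y^{(0)}=1$, $x=x^{(1)}$, $y=y^{(1)}$, $\bar x=x^{(p^{n_1}-1)}$, $\bar y=y^{(p^{n_2}-1)}$. Let $\partial_1,\partial_2$ be the derivations with $\partial_1(x^{(i)}y^{(j)})=x^{(i-1)}y^{(j)}$ and $\partial_2(x^{(i)}y^{(j)})=x^{(i)}y^{(j-1)}$, where $x^{(-1)}=y^{(-1)}=0$. The Hamiltonian Lie algebra $H(2;(n_1,n_2);\Phi(1))$ is identified with the vector space $\mathcal{O}(2;(n_1,n_2))$ with the Lie bracket $$\{f,g\}=\partial_2(f)\partial_1(g)-\partial_1(f)\partial_2(g)+\bar x\bigl(\partial_2(f)\,g-f\,\partial_2(g)\bigr).$$ Loop algebra. Let $S=\bigoplus_{k\in\mathbb{Z}/M\mathbb{Z}}S_k$ be a finite-dimensional Lie algebra over $\mathbb{F}$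 with a grading over $\mathbb{Z}/M\mathbb{Z}$, and let $t$ be an indeterminate. The loop algebra of $S$ with respect to the grading is the Lie subalgebra of $S\otimes\mathbb{F}[t]$ generated by $S_{\bar 1}\otimes t$. It is graded over the positive integers by the degree in $t$. Thin Lie algebras. A graded Lie algebra $L=\bigoplus_{i\ge1}L_i$ over $\mathbb{F}$ is thin if $\dim L_1=2$ and the covering property holds: $L_{i+1}=[u,L_1]$ for every $0\ne u\in L_i$ and all $i\ge1$. Thin Lie algebras are assumed to be infinite-dimensional. Every component then has dimension at most $2$; the components of dimension $2$ are called diamonds. $L_1$ is the first diamond, and one requires at least one further diamond; the second diamond is the one of next smallest degree. Diamond types. Let $L$ be a thin Lie algebra in odd characteristic $p$ with second diamond in degree $q$, a power of $p$. Types are assigned to the diamonds of degree greater than $1$, with respect to generators $X_L,Y_L$ spanning $L_1$ such that $[L_2,Y_L]=0$ (this condition is required only if $q>3$) and $[V,X_L,X_L]=0=[V,Y_L,Y_L]$, $[V,Y_L,X_L]=-2[V,X_L,Y_L]$ for $0\ne V\in L_{q-1}$. In the statement one takes $X_L=X\otimes t$, $Y_L=Y\otimes t$. A diamond $L_i$ with $i>1$, where $L_{i-1}=\mathbb{F}V$ is one-dimensional, has (finite) type $\mu\in\mathbb{F}$ if $$[V,Y_L,Y_L]=0=[V,X_L,X_L],\qquad (1-\mu)[V,X_L,Y_L]=\mu[V,Y_L,X_L].$$ It has type $\infty$ if $[V,Y_L,Y_L]=0=[V,X_L,X_L]$ and $-[V,X_L,Y_L]=[V,Y_L,X_L]$.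 *)

theory Defs
  imports
    "HOL-Computational_Algebra.Polynomial"
    "HOL-Library.Function_Algebras"
    "HOL-Number_Theory.Cong"
begin

section \<open>Lie algebras and gradings\<close>

text \<open>A Lie algebra is a subspace \<open>L\<close> of an ambient vector space, with a bracket that only
  has to behave on \<open>L\<close>.\<close>

locale lie_algebra = vector_space scale
  for scale :: "'a::field \<Rightarrow> 'b::ab_group_add \<Rightarrow> 'b" +
  fixes L :: "'b set" and bracket :: "'b \<Rightarrow> 'b \<Rightarrow> 'b"
  assumes subspace_carrier: "subspace L"
    and bracket_closed: "\<lbrakk>a \<in> L; b \<in> L\<rbrakk> \<Longrightarrow> bracket a b \<in> L"
    and bracket_add_left:
      "\<lbrakk>a \<in> L; b \<in> L; c \<in> L\<rbrakk> \<Longrightarrow> bracket (a + b) c = bracket a c + bracket b c"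
    and bracket_add_right:
      "\<lbrakk>a \<in> L; b \<in> L; c \<in> L\<rbrakk> \<Longrightarrow> bracket a (b + c) = bracket a b + bracket a c"
    and bracket_scale_left: "\<lbrakk>a \<in> L; b \<in> L\<rbrakk> \<Longrightarrow> bracket (scale k a) b = scale k (bracket a b)"
    and bracket_scale_right: "\<lbrakk>a \<in> L; b \<in> L\<rbrakk> \<Longrightarrow> bracket a (scale k b) = scale k (bracket a b)"
    and bracket_self: "a \<in> L \<Longrightarrow> bracket a a = 0"
    and jacobi: "\<lbrakk>a \<in> L; b \<in> L; c \<in> L\<rbrakk> \<Longrightarrow>
      bracket (bracket a b) c + bracket (bracket b c) a + bracket (bracket c a) b = 0"
begin

definition subalgebra :: "'b set \<Rightarrow> bool" where
  "subalgebra V \<longleftrightarrow> V \<subseteq> L \<and> subspace V \<and> (\<forall>a\<in>V. \<forall>b\<in>V. bracket a b \<in> V)"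

definition generated :: "'b set \<Rightarrow> 'b set" where
  "generated A = subalgebra hull A"

definition direct_sum :: "'i set \<Rightarrow> ('i \<Rightarrow> 'b set) \<Rightarrow> bool" where
  "direct_sum I C \<longleftrightarrow>
     (\<forall>k\<in>I. subspace (C k) \<and> C k \<subseteq> L) \<and>
     (\<forall>v\<in>L. \<exists>!f. (\<forall>k\<in>I. f k \<in> C k) \<and> (\<forall>k. k \<notin> I \<longrightarrow> f k = 0) \<and>
        finite {k. f k \<noteq> 0} \<and> v = (\<Sum>k | f k \<noteq> 0. f k))"

end

text \<open>A grading over \<open>\<int>/M\<int>\<close>, written as a family indexed by integers in which congruent
  indices denote the same component.\<close>

locale cyclic_graded_lie_algebra = lie_algebra scale L bracket
  for scale :: "'a::field \<Rightarrow> 'b::ab_group_add \<Rightarrow> 'b" and L bracket +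
  fixes M :: nat and C :: "int \<Rightarrow> 'b set"
  assumes modulus_pos: "M > 0"
    and component_cong: "[j = k] (mod int M) \<Longrightarrow> C j = C k"
    and direct_sum_components: "direct_sum {0..<int M} C"
    and bracket_component: "\<lbrakk>a \<in> C j; b \<in> C k\<rbrakk> \<Longrightarrow> bracket a b \<in> C (j + k)"
begin

definition graded_basis :: "'b set \<Rightarrow> bool" where
  "graded_basis B \<longleftrightarrow> B \<subseteq> (\<Union>k. C k) \<and> independent B \<and> span B = L"

end

text \<open>A grading over the positive integers; \<open>C 0\<close> is irrelevant.\<close>

locale graded_lie_algebra = lie_algebra scale L bracket
  for scale :: "'a::field \<Rightarrow> 'b::ab_group_add \<Rightarrow> 'b" and L bracket +
  fixes C :: "nat \<Rightarrow> 'b set"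
  assumes direct_sum_components: "direct_sum {1..} C"
    and bracket_component:
      "\<lbrakk>i \<ge> 1; j \<ge> 1; a \<in> C i; b \<in> C j\<rbrakk> \<Longrightarrow> bracket a b \<in> C (i + j)"


section \<open>Thin Lie algebras\<close>

datatype 'a diamond_type = Finite_Type 'a | Infinite_Type

locale thin_lie_algebra = graded_lie_algebra scale L bracket C
  for scale :: "'a::field \<Rightarrow> 'b::ab_group_add \<Rightarrow> 'b" and L bracket C +
  assumes dim_first: "dim (C 1) = 2"
    and covering: "\<lbrakk>i \<ge> 1; u \<in> C i; u \<noteq> 0\<rbrakk> \<Longrightarrow> C (i + 1) = bracket u ` C 1"
    and infinite_dimensional: "\<not> (\<exists>B. finite B \<and> span B = L)"
    and further_diamond: "\<exists>i>1. dim (C i) = 2"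
begin

definition diamond :: "nat \<Rightarrow> bool" where
  "diamond i \<longleftrightarrow> i \<ge> 1 \<and> dim (C i) = 2"

definition second_diamond :: "nat \<Rightarrow> bool" where
  "second_diamond d \<longleftrightarrow> d > 1 \<and> diamond d \<and> (\<forall>i. 1 < i \<and> i < d \<longrightarrow> \<not> diamond i)"

text \<open>The normalisation of the generators with respect to which diamond types are assigned,
  where \<open>q\<close> is the degree of the second diamond.\<close>

definition type_generators :: "nat \<Rightarrow> 'b \<Rightarrow> 'b \<Rightarrow> bool" where
  "type_generators q X Y \<longleftrightarrow>
     span {X, Y} = C 1 \<and>
     (q > 3 \<longrightarrow> (\<forall>u\<in>C 2. bracket u Y = 0)) \<and>
     (\<forall>V\<in>C (q - 1). V \<noteq> 0 \<longrightarrow>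
        bracket (bracket V X) X = 0 \<and> bracket (bracket V Y) Y = 0 \<and>
        bracket (bracket V Y) X = scale (- 2) (bracket (bracket V X) Y))"

fun type_relation :: "'b \<Rightarrow> 'b \<Rightarrow> 'b \<Rightarrow> 'a diamond_type \<Rightarrow> bool" where
  "type_relation X Y V (Finite_Type \<mu>) \<longleftrightarrow>
     scale (1 - \<mu>) (bracket (bracket V X) Y) = scale \<mu> (bracket (bracket V Y) X)"
| "type_relation X Y V Infinite_Type \<longleftrightarrow>
     - bracket (bracket V X) Y = bracket (bracket V Y) X"

definition has_type :: "'b \<Rightarrow> 'b \<Rightarrow> nat \<Rightarrow> 'a diamond_type \<Rightarrow> bool" where
  "has_type X Y i T \<longleftrightarrow> i > 1 \<and> diamond i \<and>
     (\<exists>V. V \<noteq> 0 \<and> C (i - 1) = span {V} \<and>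
        bracket (bracket V Y) Y = 0 \<and> bracket (bracket V X) X = 0 \<and> type_relation X Y V T)"

end


section \<open>Loop algebras\<close>

text \<open>The tensor product \<open>S \<otimes> \<FF>[t]\<close> is modelled by the polynomials in \<open>t\<close> with coefficients
  in \<open>S\<close>; \<open>s \<otimes> t\<^sup>k\<close> is \<^term>\<open>monom s k\<close>.\<close>

definition tensor_scale :: "('a \<Rightarrow> 'b \<Rightarrow> 'b) \<Rightarrow> 'a \<Rightarrow> 'b::ab_group_add poly \<Rightarrow> 'b poly" where
  "tensor_scale scale c = map_poly (scale c)"

definition tensor_carrier :: "'b::ab_group_add set \<Rightarrow> 'b poly set" where
  "tensor_carrier S = {P. \<forall>k. coeff P k \<in> S}"

definition tensor_bracket ::
  "('b \<Rightarrow> 'b \<Rightarrow> 'b) \<Rightarrow> 'b::ab_group_add poly \<Rightarrow> 'b poly \<Rightarrow> 'b poly" where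
  "tensor_bracket bracket P Q =
     (\<Sum>i\<le>degree P. \<Sum>j\<le>degree Q. monom (bracket (coeff P i) (coeff Q j)) (i + j))"

definition loop_algebra ::
  "('a::field \<Rightarrow> 'b \<Rightarrow> 'b) \<Rightarrow> 'b set \<Rightarrow> ('b \<Rightarrow> 'b \<Rightarrow> 'b) \<Rightarrow> (int \<Rightarrow> 'b set) \<Rightarrow>
    'b::ab_group_add poly set" where
  "loop_algebra scale S bracket C =
     lie_algebra.generated (tensor_scale scale) (tensor_carrier S) (tensor_bracket bracket)
       ((\<lambda>s. monom s 1) ` C 1)"

definition loop_component ::
  "('a::field \<Rightarrow> 'b \<Rightarrow> 'b) \<Rightarrow> 'b set \<Rightarrow> ('b \<Rightarrow> 'b \<Rightarrow> 'b) \<Rightarrow> (int \<Rightarrow> 'b set) \<Rightarrow>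
    nat \<Rightarrow> 'b::ab_group_add poly set" where
  "loop_component scale S bracket C k = loop_algebra scale S bracket C \<inter> range (\<lambda>s. monom s k)"


section \<open>The divided power algebra and the Hamiltonian Lie algebra\<close>

text \<open>An element of \<open>\<O>(2; (n\<^sub>1, n\<^sub>2))\<close>, with \<open>r = p ^ n\<^sub>1\<close> and \<open>q = p ^ n\<^sub>2\<close>, is represented by its
  coefficient function: \<open>f i j\<close> is the coefficient of \<open>x\<^sup>(\<^sup>i\<^sup>) y\<^sup>(\<^sup>j\<^sup>)\<close>.\<close>

definition dp_carrier :: "nat \<Rightarrow> nat \<Rightarrow> (nat \<Rightarrow> nat \<Rightarrow> 'a::field) set" where
  "dp_carrier r q = {f. \<forall>i j. i \<ge> r \<or> j \<ge> q \<longrightarrow> f i j = 0}"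

definition dp_scale :: "'a::field \<Rightarrow> (nat \<Rightarrow> nat \<Rightarrow> 'a) \<Rightarrow> nat \<Rightarrow> nat \<Rightarrow> 'a" where
  "dp_scale c f = (\<lambda>i j. c * f i j)"

definition dp_monom :: "nat \<Rightarrow> nat \<Rightarrow> nat \<Rightarrow> nat \<Rightarrow> 'a::field" where
  "dp_monom i j = (\<lambda>k l. if k = i \<and> l = j then 1 else 0)"

text \<open>The product has its own name: \<open>(*)\<close> on functions is pointwise multiplication.\<close>

definition dp_mult ::
  "nat \<Rightarrow> nat \<Rightarrow> (nat \<Rightarrow> nat \<Rightarrow> 'a::field) \<Rightarrow> (nat \<Rightarrow> nat \<Rightarrow> 'a) \<Rightarrow> nat \<Rightarrow> nat \<Rightarrow> 'a" where
  "dp_mult r q f g = (\<lambda>m n. if m < r \<and> n < q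
     then \<Sum>i\<le>m. \<Sum>j\<le>n. of_nat (m choose i) * of_nat (n choose j) * f i j * g (m - i) (n - j)
     else 0)"

definition dp_deriv1 :: "(nat \<Rightarrow> nat \<Rightarrow> 'a::field) \<Rightarrow> nat \<Rightarrow> nat \<Rightarrow> 'a" where
  "dp_deriv1 f = (\<lambda>i j. f (Suc i) j)"

definition dp_deriv2 :: "(nat \<Rightarrow> nat \<Rightarrow> 'a::field) \<Rightarrow> nat \<Rightarrow> nat \<Rightarrow> 'a" where
  "dp_deriv2 f = (\<lambda>i j. f i (Suc j))"

definition hamiltonian_bracket ::
  "nat \<Rightarrow> nat \<Rightarrow> (nat \<Rightarrow> nat \<Rightarrow> 'a::field) \<Rightarrow> (nat \<Rightarrow> nat \<Rightarrow> 'a) \<Rightarrow> nat \<Rightarrow> nat \<Rightarrow> 'a" where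
  "hamiltonian_bracket r q f g =
     dp_mult r q (dp_deriv2 f) (dp_deriv1 g) - dp_mult r q (dp_deriv1 f) (dp_deriv2 g)
     + dp_mult r q (dp_monom (r - 1) 0)
         (dp_mult r q (dp_deriv2 f) g - dp_mult r q f (dp_deriv2 g))"

lemma vector_space_dp_scale: "vector_space dp_scale"
  by unfold_locales (auto simp: dp_scale_def fun_eq_iff algebra_simps)

lemma dp_mult_monom:
  "dp_mult r q (dp_monom i j) (dp_monom k l) =
     (if i + k < r \<and> j + l < q
      then dp_scale (of_nat ((i + k) choose i) * of_nat ((j + l) choose j))
             (dp_monom (i + k) (j + l))
      else 0 :: nat \<Rightarrow> nat \<Rightarrow> 'a::field)"
proof (intro ext)
  fix m n
  let ?c = "of_nat (m choose i) * of_nat (n choose j) :: 'a"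
  have "(\<Sum>a\<le>m. \<Sum>b\<le>n. of_nat (m choose a) * of_nat (n choose b) *
          (dp_monom i j a b :: 'a) * dp_monom k l (m - a) (n - b))
      = (\<Sum>a\<le>m. \<Sum>b\<le>n. if b = j then
           (if a = i then ?c * dp_monom k l (m - i) (n - j) else 0) else 0)"
    by (intro sum.cong refl) (simp add: dp_monom_def)
  also have "\<dots> = (if i \<le> m \<and> j \<le> n then ?c * dp_monom k l (m - i) (n - j) else 0)"
    by (cases "j \<le> n") simp_all
  also have "\<dots> = (if m = i + k \<and> n = j + l then ?c else 0)"
    by (auto simp: dp_monom_def)
  finally show "dp_mult r q (dp_monom i j) (dp_monom k l) m n =
     (if i + k < r \<and> j + l < q
      then dp_scale (of_nat ((i + k) choose i) * of_nat ((j + l) choose j))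
             (dp_monom (i + k) (j + l))
      else 0 :: nat \<Rightarrow> nat \<Rightarrow> 'a) m n"
    by (auto simp: dp_mult_def dp_scale_def dp_monom_def)
qed

lemma dp_deriv1_monom: "dp_deriv1 (dp_monom i j) = (if i = 0 then 0 else dp_monom (i - 1) j)"
  by (auto simp: dp_deriv1_def dp_monom_def fun_eq_iff)

lemma dp_deriv2_monom: "dp_deriv2 (dp_monom i j) = (if j = 0 then 0 else dp_monom i (j - 1))"
  by (auto simp: dp_deriv2_def dp_monom_def fun_eq_iff)

end

theory Submission
  imports Defs
begin


text \<open>
  Everything rests on how bracketing with the two generators moves the monomials
  \<open>m i j = x^(i) y^(j)\<close>. Bracketing with \<open>X\<close> on the right is \<open>\<partial>\<^sub>2\<close>, so it lowers the exponent of \<open>y\<close> by one.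
  Bracketing with \<open>Y\<close> annihilates \<open>m i j\<close> for \<open>j \<ge> 2\<close>, and for \<open>j = 0\<close> and \<open>j = 1\<close> it returns a nonzero
  multiple of \<open>m (i - 1) (q - 2)\<close> and \<open>m (i - 1) (q - 1)\<close>, with \<open>i - 1\<close> read modulo \<open>r\<close>: the summand of
  the bracket that involves \<open>x^(r - 1)\<close> is what closes the cycle (\<open>br_X\<close>, \<open>br_Y_0\<close>, \<open>br_Y_1\<close>). The
  coefficient in the case \<open>j = 1\<close> is \<open>1\<close>, except for \<open>i = 0\<close>, where it is \<open>2\<close>; this single
  exception is responsible for the diamonds of type \<open>- 1\<close>.

  Consequently every monomial of degree \<open>k + 1\<close> is a multiple of the bracket of a monomial of degree
  \<open>k\<close> with \<open>X\<close> or \<open>Y\<close>. Hence a family of subspaces that contains \<open>X\<close> and \<open>Y\<close> in degree one and is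
  stable under bracketing with them contains every component of the grading (\<open>comp_minimal\<close>). This
  one fact gives that \<open>X\<close> and \<open>Y\<close> generate \<open>H\<close>, that the grading is unique, and that the loop
  algebra fills the whole component \<open>comp k\<close> in each degree \<open>k \<ge> 1\<close> (\<open>N_eq\<close>).

  For \<open>0 < j < q\<close> the degree of \<open>m i j\<close> determines \<open>(i, j)\<close>, and the monomials with \<open>j = 0\<close> have the
  degrees of those with \<open>j = q - 1\<close> (\<open>deg_cong_iff\<close>). So components are one-dimensional, except in the
  degrees congruent to \<open>1\<close> modulo \<open>q - 1\<close>, where they are spanned by \<open>m i (q - 1)\<close> and
  \<open>m (i + 1) 0\<close>. The covering property (\<open>covering_H\<close>) and the diamond types (\<open>diamond_type\<close>) are then
  read off from the brackets with \<open>X\<close> and \<open>Y\<close>.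

  The Jacobi identity for \<open>H\<close> is obtained by embedding the truncated divided power algebra into the
  ring of all divided power series, which is possible because the binomial coefficients that
  truncation suppresses vanish in characteristic \<open>p\<close> (\<open>embed_mult\<close>). In that commutative ring the
  identity is a formal computation with two commuting derivations (\<open>twisted_jacobi\<close>).
\<close>

section \<open>The ring of divided power series\<close>

text \<open>Sequences under binomial convolution, that is, formal sums of divided powers with the \<open>n\<close>-th entry
  as coefficient of \<open>x^(n)\<close>. Iterating the construction gives two variables.\<close>

datatype 'a divpow = Divpow (dpnth: "nat \<Rightarrow> 'a")

lemma divpow_eqI: "(\<And>n. dpnth F n = dpnth G n) \<Longrightarrow> F = G"
  by (cases F; cases G) auto

instantiation divpow :: (comm_ring_1) ab_group_add
begin

definition "0 = Divpow (\<lambda>n. 0)"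
definition "F + G = Divpow (\<lambda>n. dpnth F n + dpnth G n)"
definition "F - G = Divpow (\<lambda>n. dpnth F n - dpnth G n)"
definition "- F = Divpow (\<lambda>n. - dpnth F n)"

instance
  by standard (auto simp: zero_divpow_def plus_divpow_def minus_divpow_def uminus_divpow_def
      intro!: divpow_eqI)

end

lemma dpnth_linear [simp]:
  "dpnth 0 n = 0" "dpnth (F + G) n = dpnth F n + dpnth G n"
  "dpnth (F - G) n = dpnth F n - dpnth G n" "dpnth (- F) n = - dpnth F n"
  by (auto simp: zero_divpow_def plus_divpow_def minus_divpow_def uminus_divpow_def)

text \<open>The derivation that sends \<open>x^(n)\<close> to \<open>x^(n - 1)\<close>.\<close>

definition dpshift :: "'a divpow \<Rightarrow> 'a divpow" where
  "dpshift F = Divpow (\<lambda>n. dpnth F (Suc n))"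

lemma dpnth_shift [simp]: "dpnth (dpshift F) n = dpnth F (Suc n)"
  by (simp add: dpshift_def)

lemma dpshift_linear [simp]:
  "dpshift 0 = 0" "dpshift (F + G) = dpshift F + dpshift G"
  "dpshift (F - G) = dpshift F - dpshift G" 
  by (auto intro!: divpow_eqI)

instantiation divpow :: (comm_ring_1) times
begin

definition "F * G = Divpow (\<lambda>n. \<Sum>i\<le>n. of_nat (n choose i) * dpnth F i * dpnth G (n - i))"

instance ..

end

lemma dpnth_mult:
  "dpnth (F * G) n = (\<Sum>i\<le>n. of_nat (n choose i) * dpnth F i * dpnth G (n - i))"
  by (simp add: times_divpow_def)

text \<open>Pascal's rule is exactly the Leibniz rule for the shift.\<close>

lemma dpshift_mult: "dpshift (F * G) = dpshift F * G + F * dpshift G"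
proof (rule divpow_eqI)
  fix n
  let ?f = "dpnth F" and ?g = "dpnth G"
  have "(\<Sum>i\<le>Suc n. of_nat (Suc n choose i) * ?f i * ?g (Suc n - i))
      = ?f 0 * ?g (Suc n) + (\<Sum>i\<le>n. of_nat (Suc n choose Suc i) * ?f (Suc i) * ?g (n - i))"
    by (subst sum.atMost_Suc_shift) simp
  also have "(\<Sum>i\<le>n. of_nat (Suc n choose Suc i) * ?f (Suc i) * ?g (n - i))
      = (\<Sum>i\<le>n. of_nat (n choose i) * ?f (Suc i) * ?g (n - i))
        + (\<Sum>i\<le>n. of_nat (n choose Suc i) * ?f (Suc i) * ?g (n - i))"
    by (simp add: sum.distrib algebra_simps)
  also have "?f 0 * ?g (Suc n) + (\<dots>) =
      (\<Sum>i\<le>n. of_nat (n choose i) * ?f (Suc i) * ?g (n - i))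
      + (\<Sum>i\<le>Suc n. of_nat (n choose i) * ?f i * ?g (Suc n - i))"
    by (subst sum.atMost_Suc_shift) simp
  also have "(\<Sum>i\<le>Suc n. of_nat (n choose i) * ?f i * ?g (Suc n - i))
      = (\<Sum>i\<le>n. of_nat (n choose i) * ?f i * ?g (Suc (n - i)))"
    by (simp add: Suc_diff_le binomial_eq_0)
  finally show "dpnth (dpshift (F * G)) n = dpnth (dpshift F * G + F * dpshift G) n"
    by (simp add: dpnth_mult)
qed

lemma dpmult_distrib_right: "((F::'a::comm_ring_1 divpow) + G) * K = F * K + G * K"
  by (auto simp: dpnth_mult algebra_simps sum.distrib intro!: divpow_eqI)

lemma dpmult_distrib_left: "(K::'a::comm_ring_1 divpow) * (F + G) = K * F + K * G"
  by (auto simp: dpnth_mult algebra_simps sum.distrib intro!: divpow_eqI)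

text \<open>A series is determined by the constant terms of its iterated shifts. As the shift is a derivation,
  ring laws propagate from the constant term to all coefficients; this avoids reindexing of multiple
  sums, here and for associativity.\<close>

lemma dpnth_commute: "dpnth (F * G) n = dpnth (G * F) n"
proof (induction n arbitrary: F G)
  case 0
  show ?case by (simp add: dpnth_mult mult.commute)
next
  case (Suc n)
  have "dpnth (dpshift (F * G)) n = dpnth (dpshift (G * F)) n"
    unfolding dpshift_mult using Suc[of "dpshift F" G] Suc[of F "dpshift G"] by simp
  then show ?case by simp
qed

lemma dpnth_assoc: "dpnth (F * G * K) n = dpnth (F * (G * K)) n"
proof (induction n arbitrary: F G K)
  case 0
  show ?case by (simp add: dpnth_mult mult.assoc)
next
  case (Suc n)
  have "dpnth (dpshift (F * G * K)) n = dpnth (dpshift (F * (G * K))) n"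
    unfolding dpshift_mult dpmult_distrib_left dpmult_distrib_right
    using Suc[of "dpshift F" G K] Suc[of F "dpshift G" K] Suc[of F G "dpshift K"] by simp
  then show ?case by simp
qed

instantiation divpow :: (comm_ring_1) comm_ring_1
begin

definition "1 = Divpow (\<lambda>n. if n = 0 then 1 else 0)"

instance
proof
  fix F G K :: "'a divpow"
  show "F * G * K = F * (G * K)" and "F * G = G * F"
    by (auto intro: divpow_eqI dpnth_assoc dpnth_commute)
  show "1 * F = F"
    by (auto simp: one_divpow_def dpnth_mult intro!: divpow_eqI)
       (subst sum.remove[of _ 0], auto)
  show "(F + G) * K = F * K + G * K"
    by (rule dpmult_distrib_right)
  have "dpnth (0 :: 'a divpow) 0 \<noteq> dpnth 1 0"
    by (simp add: one_divpow_def)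
  then show "(0 :: 'a divpow) \<noteq> 1"
    by metis
qed

end

lemma dpnth_of_nat_mult: "dpnth (of_nat c * F) n = of_nat c * dpnth F n"
  by (induction c) (auto simp: algebra_simps)

lemma dpshift_of_nat_mult: "dpshift (of_nat c * F) = of_nat c * dpshift F"
  by (auto simp: dpnth_of_nat_mult intro: divpow_eqI)

lemma dpnth_sum: "dpnth (\<Sum>i\<in>A. f i) n = (\<Sum>i\<in>A. dpnth (f i) n)"
  by (induction A rule: infinite_finite_induct) auto

lemma dpshift_sum: "dpshift (\<Sum>i\<in>A. f i) = (\<Sum>i\<in>A. dpshift (f i))"
  by (induction A rule: infinite_finite_induct) auto

text \<open>On series in two variables, where the coefficients of \<open>x^(n)\<close> are series in \<open>y\<close>, the shift is
  \<open>\<partial>\<^sub>1\<close> and its coefficientwise application is \<open>\<partial>\<^sub>2\<close>.\<close>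

definition dpinner :: "'a divpow divpow \<Rightarrow> 'a divpow divpow" where
  "dpinner F = Divpow (\<lambda>n. dpshift (dpnth F n))"

lemma dpnth_inner [simp]: "dpnth (dpinner F) n = dpshift (dpnth F n)"
  by (simp add: dpinner_def)

lemma dpinner_linear [simp]:
  "dpinner 0 = 0" "dpinner (F + G) = dpinner F + dpinner G"
  "dpinner (F - G) = dpinner F - dpinner G"
  by (auto intro!: divpow_eqI)

lemma dpinner_mult: "dpinner (F * G) = dpinner F * G + F * dpinner G"
  by (rule divpow_eqI)
     (simp add: dpnth_mult dpshift_sum dpshift_of_nat_mult mult.assoc dpshift_mult[of "dpnth F _"]
        distrib_left sum.distrib)

lemma dpinner_dpshift: "dpinner (dpshift F) = dpshift (dpinner F)"
  by (auto intro!: divpow_eqI)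


section \<open>The Jacobi identity from two commuting derivations\<close>

locale commuting_derivations =
  fixes d1 d2 :: "'r::comm_ring_1 \<Rightarrow> 'r" and w :: 'r
  assumes add1: "d1 (f + g) = d1 f + d1 g" and add2: "d2 (f + g) = d2 f + d2 g"
    and diff1: "d1 (f - g) = d1 f - d1 g" and diff2: "d2 (f - g) = d2 f - d2 g"
    and mult1: "d1 (f * g) = d1 f * g + f * d1 g" and mult2: "d2 (f * g) = d2 f * g + f * d2 g"
    and commute: "d2 (d1 f) = d1 (d2 f)"
    and const2: "d2 w = 0"
begin

definition twisted where
  "twisted f g = d2 f * d1 g - d1 f * d2 g + w * (d2 f * g - f * d2 g)"

text \<open>The twisted bracket is \<open>d2 f * E g - E f * d2 g\<close> with \<open>E f = d1 f + w * f\<close>. Formally \<open>E\<close> is the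
  conjugate of \<open>d1\<close> by the exponential of an integral of \<open>w\<close>, which makes the bracket a rescaled
  Poisson bracket in two variables; \<open>d2 w = 0\<close> ensures that \<open>E\<close> still commutes with \<open>d2\<close>.\<close>

lemma twisted_jacobi:
  "twisted (twisted f g) h + twisted (twisted g h) f + twisted (twisted h f) g = 0"
  unfolding twisted_def add1 add2 diff1 diff2 mult1 mult2 commute const2
  by (simp add: algebra_simps)

end


section \<open>Lie subalgebras and extension of scalars to polynomials\<close>

context lie_algebra
begin

lemma subalgebra_carrier: "subalgebra L"
  by (simp add: subalgebra_def subspace_carrier bracket_closed)

lemma generated_minimal: "\<lbrakk>A \<subseteq> V; subalgebra V\<rbrakk> \<Longrightarrow> generated A \<subseteq> V"
  unfolding generated_def by (rule hull_minimal)

lemma generated_superset: "A \<subseteq> generated A"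
  unfolding generated_def by (rule hull_subset)

lemma subalgebra_generated:
  assumes "A \<subseteq> L"
  shows "subalgebra (generated A)"
  using assms subalgebra_carrier unfolding generated_def hull_def
  by (auto simp: subalgebra_def intro!: subspace_Inter)

lemma lie_algebra_subalgebra: "subalgebra V \<Longrightarrow> lie_algebra scale V bracket"
  by unfold_locales
     (auto simp: subalgebra_def subset_eq bracket_add_left bracket_add_right
        bracket_scale_left bracket_scale_right bracket_self jacobi)


lemma bracket_zero: "a \<in> L \<Longrightarrow> bracket a 0 = 0" "a \<in> L \<Longrightarrow> bracket 0 a = 0"
  using bracket_scale_right[of a a 0] bracket_scale_left[of a a 0] by auto

lemma bracket_antisym: "\<lbrakk>a \<in> L; b \<in> L\<rbrakk> \<Longrightarrow> bracket a b + bracket b a = 0"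
  using bracket_self[of "a + b"] bracket_add_left[of a b "a + b"] bracket_add_right[of a a b]
    bracket_add_right[of b a b] subspace_add[OF subspace_carrier, of a b] bracket_self
  by simp

lemma zero_in_carrier: "0 \<in> L"
  by (rule subspace_0[OF subspace_carrier])

lemma coeff_tensor_scale [simp]: "coeff (tensor_scale scale c P) n = scale c (coeff P n)"
  by (simp add: tensor_scale_def coeff_map_poly)

lemma tensor_scale_monom: "tensor_scale scale c (monom a n) = monom (scale c a) n"
  by (rule poly_eqI) simp

lemma vector_space_tensor: "vector_space (tensor_scale scale)"
  by unfold_locales (auto intro!: poly_eqI simp: scale_right_distrib scale_left_distrib)

lemma tensor_carrier_add: "\<lbrakk>P \<in> tensor_carrier L; Q \<in> tensor_carrier L\<rbrakk> \<Longrightarrow> P + Q \<in> tensor_carrier L"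
  by (auto simp: tensor_carrier_def intro: subspace_add subspace_carrier)

lemma tensor_carrier_zero: "0 \<in> tensor_carrier L"
  by (simp add: tensor_carrier_def zero_in_carrier)

lemma tensor_carrier_monom: "a \<in> L \<Longrightarrow> monom a n \<in> tensor_carrier L"
  by (simp add: tensor_carrier_def zero_in_carrier)

lemma tensor_carrier_sum:
  "(\<And>i. i \<in> I \<Longrightarrow> F i \<in> tensor_carrier L) \<Longrightarrow> sum F I \<in> tensor_carrier L"
  by (induction I rule: infinite_finite_induct) (auto intro: tensor_carrier_add tensor_carrier_zero)

text \<open>For reducing multilinear identities on \<open>L \<otimes> \<FF>[t]\<close> to homogeneous elements \<open>a \<otimes> t^n\<close>.\<close>

lemma tensor_induct [consumes 1, case_names monom add]:
  assumes P: "P \<in> tensor_carrier L"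
    and monom: "\<And>a n. a \<in> L \<Longrightarrow> \<Phi> (monom a n)"
    and add: "\<And>P Q. \<lbrakk>P \<in> tensor_carrier L; Q \<in> tensor_carrier L; \<Phi> P; \<Phi> Q\<rbrakk> \<Longrightarrow> \<Phi> (P + Q)"
  shows "\<Phi> P"
proof -
  have coeff: "coeff P n \<in> L" for n
    using P by (simp add: tensor_carrier_def)
  have "\<Phi> (\<Sum>i\<in>I. monom (coeff P i) i)" if "finite I" for I
    using that
  proof induction
    case empty
    show ?case using monom[OF zero_in_carrier, of 0] by simp
  next
    case (insert i I)
    then show ?case
      by (auto intro!: add monom coeff tensor_carrier_sum tensor_carrier_monom)
  qed
  from this[of "{..degree P}"] show ?thesis
    by (simp add: poly_as_sum_of_monoms)
qed

abbreviation tbr :: "'b poly \<Rightarrow> 'b poly \<Rightarrow> 'b poly" where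
  "tbr \<equiv> tensor_bracket bracket"

text \<open>The defining double sum runs up to the degrees of the factors, which change under addition; common
  larger bounds make the bracket visibly bilinear.\<close>

lemma tensor_bracket_bound:
  assumes "P \<in> tensor_carrier L" "Q \<in> tensor_carrier L" "degree P \<le> m" "degree Q \<le> n"
  shows "tbr P Q = (\<Sum>i\<le>m. \<Sum>j\<le>n. monom (bracket (coeff P i) (coeff Q j)) (i + j))"
proof -
  have coeff: "coeff P i \<in> L" "coeff Q i \<in> L" for i
    using assms by (auto simp: tensor_carrier_def)
  have "tbr P Q = (\<Sum>i\<le>degree P. \<Sum>j\<le>n. monom (bracket (coeff P i) (coeff Q j)) (i + j))"
    unfolding tensor_bracket_def
    using assms(4) coeff by (intro sum.cong refl sum.mono_neutral_left)
      (auto simp: bracket_zero coeff_eq_0)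
  also have "\<dots> = (\<Sum>i\<le>m. \<Sum>j\<le>n. monom (bracket (coeff P i) (coeff Q j)) (i + j))"
    using assms(3) coeff by (intro sum.mono_neutral_left) (auto simp: bracket_zero coeff_eq_0)
  finally show ?thesis .
qed

lemma tensor_bracket_monom:
  assumes "a \<in> L" "b \<in> L"
  shows "tbr (monom a i) (monom b j) = monom (bracket a b) (i + j)"
proof -
  have "tbr (monom a i) (monom b j) 
      = (\<Sum>k\<le>i. \<Sum>l\<le>j. if l = j then if k = i then monom (bracket a b) (i + j) else 0 else 0)"
    unfolding tensor_bracket_bound[OF tensor_carrier_monom[OF assms(1)] tensor_carrier_monom[OF assms(2)]
        degree_monom_le degree_monom_le]
    using assms by (intro sum.cong refl) (auto simp: bracket_zero zero_in_carrier)
  then show ?thesis by simp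
qed

lemma tensor_bracket_closed:
  "\<lbrakk>P \<in> tensor_carrier L; Q \<in> tensor_carrier L\<rbrakk> \<Longrightarrow> tbr P Q \<in> tensor_carrier L"
  unfolding tensor_bracket_def
  by (intro tensor_carrier_sum tensor_carrier_monom bracket_closed) (auto simp: tensor_carrier_def)

lemma tensor_bracket_add_left:
  assumes "P \<in> tensor_carrier L" "P' \<in> tensor_carrier L" "Q \<in> tensor_carrier L"
  shows "tbr (P + P') Q = tbr P Q + tbr P' Q"
proof -
  let ?m = "max (degree P) (degree P')"
  have "tbr (P + P') Q
      = (\<Sum>i\<le>?m. \<Sum>j\<le>degree Q. monom (bracket (coeff P i + coeff P' i) (coeff Q j)) (i + j))"
    using tensor_bracket_bound[OF tensor_carrier_add[OF assms(1,2)] assms(3) degree_add_le_max order_refl]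
    by simp
  also have "\<dots> = (\<Sum>i\<le>?m. \<Sum>j\<le>degree Q. monom (bracket (coeff P i) (coeff Q j)) (i + j)
      + monom (bracket (coeff P' i) (coeff Q j)) (i + j))"
    using assms by (simp add: tensor_carrier_def bracket_add_left add_monom)
  also have "\<dots> = tbr P Q + tbr P' Q"
    using tensor_bracket_bound[OF assms(1,3), of ?m "degree Q"]
      tensor_bracket_bound[OF assms(2,3), of ?m "degree Q"]
    by (simp add: sum.distrib)
  finally show ?thesis .
qed

lemma tensor_bracket_antisym:
  assumes "P \<in> tensor_carrier L" "Q \<in> tensor_carrier L"
  shows "tbr P Q + tbr Q P = 0"
proof -
  have "(tbr P Q + tbr Q P) = (\<Sum>i\<le>degree P. \<Sum>j\<le>degree Q.
      monom (bracket (coeff P i) (coeff Q j) + bracket (coeff Q j) (coeff P i)) (i + j))"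
    unfolding tensor_bracket_def
    by (subst (2) sum.swap) (simp add: add_monom[symmetric] sum.distrib add.commute)
  also have "\<dots> = 0"
    using assms by (simp add: bracket_antisym tensor_carrier_def)
  finally show ?thesis .
qed

lemma tensor_bracket_add_right:
  assumes P: "P \<in> tensor_carrier L" and Q: "Q \<in> tensor_carrier L" "Q' \<in> tensor_carrier L"
  shows "tbr P (Q + Q') = tbr P Q + tbr P Q'"
  using tensor_bracket_antisym[OF P tensor_carrier_add[OF Q]] tensor_bracket_antisym[OF P Q(1)]
    tensor_bracket_antisym[OF P Q(2)] tensor_bracket_add_left[OF Q P]
  by (simp add: eq_neg_iff_add_eq_0[symmetric])

lemma tensor_bracket_self: "P \<in> tensor_carrier L \<Longrightarrow> tbr P P = 0"
proof (induction rule: tensor_induct)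
  case (monom a n)
  then show ?case by (simp add: tensor_bracket_monom bracket_self)
next
  case (add P Q)
  then show ?case
    by (simp add: tensor_bracket_add_left tensor_bracket_add_right tensor_carrier_add
        tensor_bracket_antisym)
qed

lemma tensor_jacobi:
  assumes "P \<in> tensor_carrier L" "Q \<in> tensor_carrier L" "R \<in> tensor_carrier L"
  shows "tbr (tbr P Q) R + tbr (tbr Q R) P + tbr (tbr R P) Q = 0"
proof -
  define J where "J P Q R = tbr (tbr P Q) R + tbr (tbr Q R) P + tbr (tbr R P) Q" for P Q R
  \<comment> \<open>Cyclic symmetry lets linearity in the first argument serve for all three arguments.\<close>
  have cyclic: "J P Q R = J Q R P" for P Q R
    by (simp add: J_def add_ac)
  have add: "J (P + P') Q R = J P Q R + J P' Q R"
    if "P \<in> tensor_carrier L" "P' \<in> tensor_carrier L" "Q \<in> tensor_carrier L" "R \<in> tensor_carrier L"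
    for P P' Q R
    using that unfolding J_def
    by (simp add: tensor_bracket_add_left tensor_bracket_add_right tensor_bracket_closed
        tensor_carrier_add)
  have 1: "J (monom a i) (monom b j) (monom c k) = 0" if "a \<in> L" "b \<in> L" "c \<in> L" for a b c i j k
    using that jacobi[OF that] unfolding J_def
    by (simp add: tensor_bracket_monom bracket_closed add_monom add_ac)
  have 2: "J P (monom b j) (monom c k) = 0" if "P \<in> tensor_carrier L" "b \<in> L" "c \<in> L" for P b c j k
    using that by (induction rule: tensor_induct) (auto simp: 1 add tensor_carrier_monom)
  have 3: "J Q (monom c k) P = 0"
    if "Q \<in> tensor_carrier L" "P \<in> tensor_carrier L" "c \<in> L" for P Q c k
    using that
  proof (induction rule: tensor_induct)
    case (monom a n)
    then show ?case using 2[of P a c n k] cyclic[of P "monom a n"] by simp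
  qed (simp add: add tensor_carrier_monom)
  have "J R P Q = 0"
    using assms(3,1,2)
  proof (induction rule: tensor_induct)
    case (monom c k)
    then show ?case using 3[of Q P c k] cyclic[of Q "monom c k" P] by simp
  qed (simp add: add)
  then show ?thesis
    using cyclic[of R P Q] by (simp add: J_def)
qed

lemma lie_algebra_tensor: "lie_algebra (tensor_scale scale) (tensor_carrier L) tbr"
proof -
  interpret T: vector_space "tensor_scale scale"
    by (rule vector_space_tensor)
  show ?thesis
  proof
    show "T.subspace (tensor_carrier L)"
      by (rule T.subspaceI)
         (auto simp: tensor_carrier_zero tensor_carrier_add,
          auto simp: tensor_carrier_def intro: subspace_scale subspace_carrier)
    fix P Q and c :: 'a
    assume PQ: "P \<in> tensor_carrier L" "Q \<in> tensor_carrier L"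
    then have coeff: "coeff P i \<in> L" "coeff Q i \<in> L" for i
      by (auto simp: tensor_carrier_def)
    have cP: "tensor_scale scale c P \<in> tensor_carrier L"
      if "P \<in> tensor_carrier L" for P
      using that by (auto simp: tensor_carrier_def intro: subspace_scale subspace_carrier)
    have deg: "degree (tensor_scale scale c P) \<le> degree P" for P
      by (rule degree_le) (simp add: coeff_eq_0)
    have sum: "tensor_scale scale c (\<Sum>i\<in>I. \<Sum>j\<in>K. monom (f i j) (i + j))
        = (\<Sum>i\<in>I. \<Sum>j\<in>K. monom (scale c (f i j)) (i + j))" for I K f
      by (simp add: T.scale_sum_right tensor_scale_monom)
    show "tbr (tensor_scale scale c P) Q = tensor_scale scale c (tbr P Q)"
      unfolding tensor_bracket_bound[OF cP[OF PQ(1)] PQ(2) deg order_refl]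
        tensor_bracket_bound[OF PQ order_refl order_refl] sum
      by (simp add: bracket_scale_left coeff)
    show "tbr P (tensor_scale scale c Q) = tensor_scale scale c (tbr P Q)"
      unfolding tensor_bracket_bound[OF PQ(1) cP[OF PQ(2)] order_refl deg]
        tensor_bracket_bound[OF PQ order_refl order_refl] sum
      by (simp add: bracket_scale_right coeff)
  qed (simp_all add: tensor_bracket_closed tensor_bracket_add_left tensor_bracket_add_right
      tensor_bracket_self tensor_jacobi)
qed

end


section \<open>The Hamiltonian algebra inside the divided power series\<close>

text \<open>In \<open>j * (p^n choose j) = p^n * (p^n - 1 choose j - 1)\<close> the number \<open>j < p^n\<close> cannot absorb all factors
  \<open>p\<close> of the right-hand side.\<close>

lemma prime_dvd_prime_power_choose:
  fixes p :: nat
  assumes "prime p" "0 < j" "j < p ^ n"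
  shows "p dvd (p ^ n choose j)"
proof (rule ccontr)
  assume "\<not> p dvd (p ^ n choose j)"
  then have "coprime (p ^ n) (p ^ n choose j)"
    using assms(1) by (simp add: prime_imp_coprime coprime_commute)
  moreover have "p ^ n dvd j * (p ^ n choose j)"
    using times_binomial_minus1_eq[OF assms(2), of "p ^ n"] by simp
  ultimately have "p ^ n dvd j"
    by (simp add: coprime_dvd_mult_left_iff)
  with assms(2,3) show False
    by (auto dest: dvd_imp_le)
qed

text \<open>Adding \<open>i\<close> and \<open>k\<close> produces a carry beyond the \<open>n\<close>-th digit in base \<open>p\<close>. With
  \<open>i + k = p^n + m\<close> one has \<open>m < i\<close>, so the term with \<open>p^n choose 0\<close> in Vandermonde's convolution
  vanishes, and the other terms contain a proper binomial coefficient of \<open>p^n\<close>.\<close>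

lemma prime_dvd_choose_overflow:
  fixes p :: nat
  assumes "prime p" "i < p ^ n" "k < p ^ n" "p ^ n \<le> i + k"
  shows "p dvd (i + k choose i)"
proof -
  define m where "m = i + k - p ^ n"
  have "i + k = p ^ n + m" "m < i"
    using assms by (auto simp: m_def)
  then have "(i + k choose i) = (\<Sum>j\<le>i. (p ^ n choose j) * (m choose (i - j)))"
    by (simp add: vandermonde)
  moreover have "p dvd (p ^ n choose j) * (m choose (i - j))" if "j \<le> i" for j
  proof (cases "j = 0")
    case True
    with \<open>m < i\<close> show ?thesis by (simp add: binomial_eq_0)
  next
    case False
    with that assms(1,2) show ?thesis
      by (intro dvd_mult2 prime_dvd_prime_power_choose) auto
  qed
  ultimately show ?thesis
    by (auto intro: dvd_sum)
qed

text \<open>The set \<open>H\<close> and the bracket are parameters tied down by equations, so that the general facts apply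
  verbatim to any algebra presented in this way; \<open>H\<close> also fixes the coefficient field.\<close>

locale hamiltonian =
  fixes p n\<^sub>1 n\<^sub>2 q r M :: nat
    and H :: "(nat \<Rightarrow> nat \<Rightarrow> 'a::field) set"
    and X Y :: "nat \<Rightarrow> nat \<Rightarrow> 'a"
    and br :: "(nat \<Rightarrow> nat \<Rightarrow> 'a) \<Rightarrow> (nat \<Rightarrow> nat \<Rightarrow> 'a) \<Rightarrow> nat \<Rightarrow> nat \<Rightarrow> 'a"
  assumes char: "CHAR('a) = p" and odd: "odd p"
    and n1: "n\<^sub>1 > 0" and n2: "n\<^sub>2 > 0"
    and q_def: "q = p ^ n\<^sub>2" and r_def: "r = p ^ n\<^sub>1" and M_def: "M = (q - 1) * r"
    and H_def: "H = dp_carrier r q" and br_def: "br = hamiltonian_bracket r q"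
    and X_def: "X = dp_monom 1 0" and Y_def: "Y = dp_monom 0 (q - 1)"
begin

lemma prime_p: "prime p"
  using prime_CHAR_semidom[where 'a = 'a] odd by (auto simp: char odd_pos)

lemma p_ge_3: "p \<ge> 3"
  using prime_ge_2_nat[OF prime_p] odd by (cases "p = 2") auto

lemma q_ge_3: "q \<ge> 3" and r_ge_3: "r \<ge> 3"
  using p_ge_3 self_le_power[of p n\<^sub>2] self_le_power[of p n\<^sub>1] n1 n2 by (auto simp: q_def r_def)

lemma M_pos: "M > 0"
  using q_ge_3 r_ge_3 by (simp add: M_def)

lemma of_nat_p_multiple: "p dvd n \<Longrightarrow> (of_nat n :: 'a) = 0"
  by (simp add: of_nat_eq_0_iff_char_dvd char)

lemma two_nonzero: "(2 :: 'a) \<noteq> 0"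
proof -
  have "(of_nat 2 :: 'a) \<noteq> 0"
    using p_ge_3 by (auto simp only: of_nat_eq_0_iff_char_dvd char dest: dvd_imp_le)
  then show ?thesis by simp
qed

lemma of_nat_q_minus_1: "(of_nat (q - 1) :: 'a) = -1"
proof -
  have "(of_nat (q - 1) :: 'a) = of_nat q - 1"
    using q_ge_3 by (simp add: of_nat_diff)
  then show ?thesis
    using n2 by (simp add: of_nat_p_multiple q_def)
qed

lemma choose_overflow_r: "\<lbrakk>i < r; k < r; r \<le> i + k\<rbrakk> \<Longrightarrow> (of_nat (i + k choose i) :: 'a) = 0"
  and choose_overflow_q: "\<lbrakk>j < q; l < q; q \<le> j + l\<rbrakk> \<Longrightarrow> (of_nat (j + l choose j) :: 'a) = 0"
  using prime_dvd_choose_overflow[OF prime_p] by (auto simp: of_nat_p_multiple q_def r_def)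

lemma H_iff: "f \<in> H \<longleftrightarrow> (\<forall>i j. i \<ge> r \<or> j \<ge> q \<longrightarrow> f i j = 0)"
  by (simp add: H_def dp_carrier_def)

lemma H_closed:
  "dp_mult r q f g \<in> H" "f \<in> H \<Longrightarrow> g \<in> H \<Longrightarrow> f + g \<in> H" "f \<in> H \<Longrightarrow> g \<in> H \<Longrightarrow> f - g \<in> H"
  "f \<in> H \<Longrightarrow> dp_scale c f \<in> H" "f \<in> H \<Longrightarrow> dp_deriv1 f \<in> H" "f \<in> H \<Longrightarrow> dp_deriv2 f \<in> H"
  "0 \<in> H" "i < r \<Longrightarrow> j < q \<Longrightarrow> dp_monom i j \<in> H"
  by (auto simp: H_iff dp_mult_def dp_scale_def dp_deriv1_def dp_deriv2_def dp_monom_def)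

lemma br_closed: "br f g \<in> H"
  by (simp add: br_def hamiltonian_bracket_def H_closed)

definition embed :: "(nat \<Rightarrow> nat \<Rightarrow> 'a) \<Rightarrow> 'a divpow divpow" where
  "embed f = Divpow (\<lambda>i. Divpow (f i))"

lemma embed_eq_iff: "embed f = embed g \<longleftrightarrow> f = g"
  by (simp add: embed_def fun_eq_iff)

lemma embed_linear: "embed (f + g) = embed f + embed g" "embed (f - g) = embed f - embed g"
  "embed 0 = 0"
  by (auto simp: embed_def intro!: divpow_eqI)

lemma embed_deriv: "embed (dp_deriv1 f) = dpshift (embed f)" "embed (dp_deriv2 f) = dpinner (embed f)"
  by (auto simp: embed_def dp_deriv1_def dp_deriv2_def intro!: divpow_eqI)

text \<open>Truncation agrees with the full product on \<open>H\<close>: each coefficient that is cut off carries a binomial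
  factor divisible by \<open>p\<close>.\<close>

lemma embed_mult:
  assumes f: "f \<in> H" and g: "g \<in> H"
  shows "embed (dp_mult r q f g) = embed f * embed g"
proof (intro divpow_eqI)
  fix m n
  let ?t = "\<lambda>i j. of_nat (m choose i) * of_nat (n choose j) * f i j * g (m - i) (n - j)"
  have product: "dpnth (dpnth (embed f * embed g) m) n = (\<Sum>i\<le>m. \<Sum>j\<le>n. ?t i j)"
    by (simp add: embed_def dpnth_mult[of _ _ m] dpnth_sum mult.assoc dpnth_of_nat_mult)
       (simp add: dpnth_mult sum_distrib_left mult.assoc)
  have overflow: "?t i j = 0" if "i \<le> m" "j \<le> n" "m \<ge> r \<or> n \<ge> q" for i j
  proof (cases "i < r \<and> j < q \<and> m - i < r \<and> n - j < q")
    case True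
    with that choose_overflow_r[of i "m - i"] choose_overflow_q[of j "n - j"]
    show ?thesis by auto
  next
    case False
    then have "f i j = 0 \<or> g (m - i) (n - j) = 0"
      using f g unfolding H_iff by (meson not_le)
    then show ?thesis by auto
  qed
  have "(\<Sum>i\<le>m. \<Sum>j\<le>n. ?t i j) = 0" if "m \<ge> r \<or> n \<ge> q"
    using overflow[OF _ _ that] by (intro sum.neutral ballI) simp
  then show "dpnth (dpnth (embed (dp_mult r q f g)) m) n = dpnth (dpnth (embed f * embed g) m) n"
    unfolding product by (auto simp: embed_def dp_mult_def)
qed

sublocale series: commuting_derivations dpshift dpinner "embed (dp_monom (r - 1) 0)"
proof
  show "dpinner (embed (dp_monom (r - 1) 0)) = 0"
    using r_ge_3 by (simp add: embed_deriv[symmetric] dp_deriv2_monom embed_linear)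
qed (auto simp: dpshift_mult dpinner_mult dpinner_dpshift)

lemma embed_br:
  assumes "f \<in> H" "g \<in> H"
  shows "embed (br f g) = series.twisted (embed f) (embed g)"
  using assms q_ge_3 r_ge_3
  by (simp add: br_def hamiltonian_bracket_def series.twisted_def embed_linear embed_deriv
      embed_mult H_closed del: One_nat_def)

lemma dp_mult_linear:
  "dp_mult r q (f + f') g = dp_mult r q f g + dp_mult r q f' g"
  "dp_mult r q f (g + g') = dp_mult r q f g + dp_mult r q f g'"
  "dp_mult r q (dp_scale c f) g = dp_scale c (dp_mult r q f g)"
  "dp_mult r q f (dp_scale c g) = dp_scale c (dp_mult r q f g)"
  by (auto simp: dp_mult_def dp_scale_def fun_eq_iff algebra_simps sum.distrib sum_distrib_left)

lemma dp_deriv_scale: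
  "dp_deriv1 (dp_scale c f) = dp_scale c (dp_deriv1 f)"
  "dp_deriv2 (dp_scale c f) = dp_scale c (dp_deriv2 f)"
  by (auto simp: dp_deriv1_def dp_deriv2_def dp_scale_def)

lemma lie_algebra_H: "lie_algebra dp_scale H br"
proof -
  interpret vector_space "dp_scale :: 'a \<Rightarrow> (nat \<Rightarrow> nat \<Rightarrow> 'a) \<Rightarrow> nat \<Rightarrow> nat \<Rightarrow> 'a"
    by (rule vector_space_dp_scale)
  note embed_inject = embed_eq_iff[THEN iffD1]
  show ?thesis
  proof
    show "subspace H"
      by (simp add: subspace_def H_closed)
    fix a b c :: "nat \<Rightarrow> nat \<Rightarrow> 'a" and k :: 'a
    assume a: "a \<in> H" and b: "b \<in> H"
    show "br a b \<in> H" by (rule br_closed)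
    show "br a a = 0"
      by (rule embed_inject) (simp add: embed_br a embed_linear series.twisted_def mult.commute
          del: One_nat_def)
    show "br (dp_scale k a) b = dp_scale k (br a b)"
      and "br a (dp_scale k b) = dp_scale k (br a b)"
      by (simp_all add: br_def hamiltonian_bracket_def dp_mult_linear dp_deriv_scale
          scale_right_diff_distrib[symmetric] scale_right_distrib[symmetric])
    assume c: "c \<in> H"
    show "br (a + b) c = br a c + br b c" "br a (b + c) = br a b + br a c"
      by (rule embed_inject; simp add: embed_br a b c H_closed embed_linear series.twisted_def
          algebra_simps del: One_nat_def)+
    show "br (br a b) c + br (br b c) a + br (br c a) b = 0"
      by (rule embed_inject) (simp add: embed_br a b c br_closed embed_linear series.twisted_jacobi
          del: One_nat_def)
  qed
qed

end


lemma sum_fun_apply2: "(\<Sum>a\<in>A. F a :: 'b \<Rightarrow> 'c \<Rightarrow> 'd::comm_monoid_add) x y = (\<Sum>a\<in>A. F a x y)"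
  by (induction A rule: infinite_finite_induct) auto

context hamiltonian
begin

sublocale lie_algebra dp_scale H br
  by (rule lie_algebra_H)

section \<open>Monomials and the grading\<close>

abbreviation m :: "nat \<Rightarrow> nat \<Rightarrow> nat \<Rightarrow> nat \<Rightarrow> 'a" where
  "m i j \<equiv> dp_monom i j"

text \<open>The exponents of \<open>x\<close> are permuted cyclically by the bracket with \<open>Y\<close>, which
  sends \<open>nxt i\<close> to \<open>i\<close>.\<close>

definition nxt :: "nat \<Rightarrow> nat" where
  "nxt i = Suc i mod r"

lemma nxt_less [simp]: "nxt i < r"
  using r_ge_3 by (simp add: nxt_def)

lemma nxt_surj: "i < r \<Longrightarrow> \<exists>i'<r. i = nxt i'"
  using r_ge_3 by (cases i) (auto simp: nxt_def intro: exI[of _ "r - 1"] exI[of _ "i - 1"])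

lemma monomial_expansion:
  assumes "f \<in> H"
  shows "f = (\<Sum>(i, j)\<in>{..<r} \<times> {..<q}. dp_scale (f i j) (m i j))"
proof (intro ext)
  fix k l
  have "(\<Sum>(i, j)\<in>{..<r} \<times> {..<q}. dp_scale (f i j) (m i j)) k l
      = (\<Sum>x\<in>{..<r} \<times> {..<q}. if x = (k, l) then f k l else 0)"
    unfolding sum_fun_apply2
    by (intro sum.cong refl) (auto simp: dp_scale_def dp_monom_def split: if_splits)
  also have "\<dots> = f k l"
    using assms by (auto simp: H_iff not_less)
  finally show "f k l = (\<Sum>(i, j)\<in>{..<r} \<times> {..<q}. dp_scale (f i j) (m i j)) k l" ..
qed

lemma in_subspace_if_monomials:
  assumes "f \<in> H" "subspace S" "\<And>i j. \<lbrakk>i < r; j < q; f i j \<noteq> 0\<rbrakk> \<Longrightarrow> m i j \<in> S"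
  shows "f \<in> S"
proof -
  have "dp_scale (f i j) (m i j) \<in> S" if "i < r" "j < q" for i j
    using assms(3)[OF that] subspace_0[OF assms(2)]
    by (cases "f i j = 0") (auto intro: subspace_scale[OF assms(2)])
  then show ?thesis
    by (subst monomial_expansion[OF assms(1)]) (auto intro!: subspace_sum assms(2))
qed

lemma monom_eq_iff: "m i j = m k l \<longleftrightarrow> i = k \<and> j = l"
proof
  assume "m i j = m k l"
  then have "m i j i j = m k l i j" by simp
  then show "i = k \<and> j = l" by (simp add: dp_monom_def split: if_splits)
qed simp

lemma monomials_inj: "inj_on (\<lambda>(i, j). m i j) A"
  by (auto simp: inj_on_def monom_eq_iff)

definition monomials :: "(nat \<Rightarrow> nat \<Rightarrow> 'a) set" where
  "monomials = (\<lambda>(i, j). m i j) ` ({..<r} \<times> {..<q})"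

lemma independent_monomials: "independent monomials"
proof (rule independent_if_scalars_zero)
  show "finite monomials" by (simp add: monomials_def)
next
  fix c b
  assume zero: "(\<Sum>x\<in>monomials. dp_scale (c x) x) = 0" and "b \<in> monomials"
  then obtain k l where kl: "k < r" "l < q" "b = m k l"
    by (auto simp: monomials_def)
  have "0 = (\<Sum>x\<in>monomials. dp_scale (c x) x) k l"
    by (simp add: zero)
  also have "\<dots> = (\<Sum>x\<in>{..<r} \<times> {..<q}. if x = (k, l) then c b else 0)"
    unfolding monomials_def sum.reindex[OF monomials_inj] sum_fun_apply2 kl(3)
    by (intro sum.cong refl) (auto simp: dp_scale_def dp_monom_def split: if_splits)
  also have "\<dots> = c b"
    using kl by simp
  finally show "c b = 0" ..
qed

lemma monomials_subset: "monomials \<subseteq> H"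
  by (auto simp: monomials_def H_closed)

lemma span_monomials: "span monomials = H"
proof
  show "span monomials \<subseteq> H"
    by (rule span_minimal[OF monomials_subset subspace_carrier])
  show "H \<subseteq> span monomials"
  proof
    fix f
    assume "f \<in> H"
    then show "f \<in> span monomials"
      by (rule in_subspace_if_monomials[OF _ subspace_span]) (auto intro!: span_base simp: monomials_def)
  qed
qed

lemma dim_H: "dim H = q * r"
proof -
  have "dim H = card monomials"
    using dim_span_eq_card_independent[OF independent_monomials] by (simp only: span_monomials)
  also have "\<dots> = q * r"
    by (simp add: monomials_def card_image[OF monomials_inj])
  finally show ?thesis .
qed

definition deg :: "nat \<Rightarrow> nat \<Rightarrow> int" where
  "deg i j = (1 - int q) * int i - int j + int q"

definition comp :: "int \<Rightarrow> (nat \<Rightarrow> nat \<Rightarrow> 'a) set" where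
  "comp k = {f \<in> H. \<forall>i j. f i j \<noteq> 0 \<longrightarrow> [deg i j = k] (mod int M)}"

lemma compD: "f \<in> comp k \<Longrightarrow> f \<in> H" "\<lbrakk>f \<in> comp k; f i j \<noteq> 0\<rbrakk> \<Longrightarrow> [deg i j = k] (mod int M)"
  by (auto simp: comp_def)

lemma compI: "\<lbrakk>f \<in> H; \<And>i j. f i j \<noteq> 0 \<Longrightarrow> [deg i j = k] (mod int M)\<rbrakk> \<Longrightarrow> f \<in> comp k"
  by (simp add: comp_def)

lemma monom_in_comp: "\<lbrakk>i < r; j < q; [deg i j = k] (mod int M)\<rbrakk> \<Longrightarrow> m i j \<in> comp k"
  by (rule compI) (auto simp: H_closed(8), auto simp: dp_monom_def split: if_splits)

lemma subspace_comp: "subspace (comp k)"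
proof (rule subspaceI)
  show "0 \<in> comp k"
    by (rule compI) (simp_all add: H_closed)
  fix f g and c :: 'a
  assume f: "f \<in> comp k"
  show "dp_scale c f \<in> comp k"
    by (rule compI) (use f in \<open>auto simp: dp_scale_def intro: compD H_closed(4)[unfolded dp_scale_def]\<close>)
  assume g: "g \<in> comp k"
  show "f + g \<in> comp k"
  proof (rule compI)
    fix i j
    assume "(f + g) i j \<noteq> 0"
    then have "f i j \<noteq> 0 \<or> g i j \<noteq> 0" by auto
    with f g show "[deg i j = k] (mod int M)"
      by (auto dest: compD(2))
  qed (use f g in \<open>auto intro: compD H_closed\<close>)
qed

lemma comp_cong: "[j = k] (mod int M) \<Longrightarrow> comp j = comp k"
  by (auto simp: comp_def cong_def)

text \<open>The product is graded by \<open>deg - q\<close>, since \<open>1\<close> has degree \<open>q\<close>.\<close>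

lemma comp_mult:
  assumes f: "f \<in> comp k" and g: "g \<in> comp l"
  shows "dp_mult r q f g \<in> comp (k + l - int q)"
proof -
  have "[deg a b = k + l - int q] (mod int M)" if nonzero: "dp_mult r q f g a b \<noteq> 0" for a b
  proof -
    from nonzero obtain i j where ij: "i \<le> a" "j \<le> b" "f i j \<noteq> 0" "g (a - i) (b - j) \<noteq> 0"
      by (auto simp: dp_mult_def split: if_splits elim!: sum.not_neutral_contains_not_neutral)
    then have "[deg i j + deg (a - i) (b - j) - int q = k + l - int q] (mod int M)"
      by (intro cong_diff cong_add cong_refl compD(2)[OF f] compD(2)[OF g])
    moreover have "deg i j + deg (a - i) (b - j) - int q = deg a b"
      using ij by (simp add: deg_def algebra_simps of_nat_diff)
    ultimately show ?thesis by simp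
  qed
  then show ?thesis by (intro compI H_closed)
qed

lemma comp_deriv1: "f \<in> comp k \<Longrightarrow> dp_deriv1 f \<in> comp (k + int q - 1)"
proof -
  assume f: "f \<in> comp k"
  have "[deg i j = k + int q - 1] (mod int M)" if "f (Suc i) j \<noteq> 0" for i j
  proof -
    have "deg i j = deg (Suc i) j + (int q - 1)"
      by (simp add: deg_def algebra_simps)
    then show ?thesis
      using cong_add[OF compD(2)[OF f that] cong_refl, of "int q - 1"] by (simp add: add_diff_eq)
  qed
  with f show ?thesis by (intro compI H_closed) (auto simp: dp_deriv1_def dest: compD)
qed

lemma comp_deriv2: "f \<in> comp k \<Longrightarrow> dp_deriv2 f \<in> comp (k + 1)"
proof -
  assume f: "f \<in> comp k"
  have "[deg i j = k + 1] (mod int M)" if "f i (Suc j) \<noteq> 0" for i j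
    using cong_add[OF compD(2)[OF f that] cong_refl, of 1] by (simp add: deg_def algebra_simps)
  with f show ?thesis by (intro compI H_closed) (auto simp: dp_deriv2_def dest: compD)
qed

text \<open>The modulus \<open>M = (q - 1) r\<close> comes from here: for a homogeneous bracket the factor \<open>x^(r - 1)\<close> has to
  have degree \<open>2 q - 1\<close>, and its actual degree differs from this by \<open>M\<close>.\<close>

lemma deg_last: "[deg (r - 1) j = 2 * int q - 1 - int j] (mod int M)"
proof -
  have "deg (r - 1) j = (2 * int q - 1 - int j) - int M"
    using r_ge_3 q_ge_3 by (simp add: deg_def M_def of_nat_diff algebra_simps)
  then show ?thesis by (simp add: cong_iff_dvd_diff)
qed

lemma comp_br:
  assumes a: "a \<in> comp j" and b: "b \<in> comp k"
  shows "br a b \<in> comp (j + k)"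
proof -
  let ?x = "m (r - 1) 0"
  have x: "?x \<in> comp (2 * int q - 1)"
    using deg_last[of 0] r_ge_3 q_ge_3 by (intro monom_in_comp) auto
  note d = comp_deriv1[OF a] comp_deriv2[OF a] comp_deriv1[OF b] comp_deriv2[OF b]
  have "dp_mult r q (dp_deriv2 a) (dp_deriv1 b) \<in> comp (j + k)"
    "dp_mult r q (dp_deriv1 a) (dp_deriv2 b) \<in> comp (j + k)"
    using comp_mult[OF d(2,3)] comp_mult[OF d(1,4)] by (simp_all add: algebra_simps)
  moreover have "dp_mult r q ?x (dp_mult r q (dp_deriv2 a) b - dp_mult r q a (dp_deriv2 b))
      \<in> comp (j + k)"
  proof -
    have "dp_mult r q (dp_deriv2 a) b \<in> comp (j + k + 1 - int q)"
      "dp_mult r q a (dp_deriv2 b) \<in> comp (j + k + 1 - int q)"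
      using comp_mult[OF d(2) b] comp_mult[OF a d(4)] by (simp_all add: algebra_simps)
    from comp_mult[OF x subspace_diff[OF subspace_comp this]] show ?thesis
      by (simp add: algebra_simps)
  qed
  ultimately show ?thesis
    unfolding br_def hamiltonian_bracket_def
    by (intro subspace_add subspace_diff subspace_comp)
qed

lemma restrict_sum:
  assumes "v \<in> H"
  defines "f \<equiv> \<lambda>k i j. if k \<in> {0..<int M} \<and> deg i j mod int M = k then v i j else 0"
  shows "finite {k. f k \<noteq> 0}" "v = (\<Sum>k | f k \<noteq> 0. f k)"
proof -
  have sub: "{k. f k \<noteq> 0} \<subseteq> {0..<int M}"
    by (auto simp: f_def fun_eq_iff split: if_splits)
  then show "finite {k. f k \<noteq> 0}"
    by (rule finite_subset) simp
  have "v i j = (\<Sum>k | f k \<noteq> 0. f k) i j" for i j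
  proof -
    have "(\<Sum>k | f k \<noteq> 0. f k) = (\<Sum>k\<in>{0..<int M}. f k)"
      using sub by (intro sum.mono_neutral_left) auto
    then have "(\<Sum>k | f k \<noteq> 0. f k) i j = (\<Sum>k\<in>{0..<int M}. if k = deg i j mod int M then v i j else 0)"
      by (simp only: sum_fun_apply2) (auto simp: f_def intro!: sum.cong)
    also have "\<dots> = v i j"
      using M_pos by simp
    finally show ?thesis ..
  qed
  then show "v = (\<Sum>k | f k \<noteq> 0. f k)" by (intro ext)
qed

lemma direct_sum_comp: "direct_sum {0..<int M} comp"
  unfolding direct_sum_def
proof (intro conjI ballI ex_ex1I)
  fix k
  show "subspace (comp k)" and "comp k \<subseteq> H"
    using subspace_comp by (auto dest: compD)
next
  fix v
  assume v: "v \<in> H"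
  let ?f = "\<lambda>k i j. if k \<in> {0..<int M} \<and> deg i j mod int M = k then v i j else 0"
  have "\<forall>k\<in>{0..<int M}. ?f k \<in> comp k"
    using v by (auto simp: comp_def H_iff cong_def)
  moreover have "\<forall>k. k \<notin> {0..<int M} \<longrightarrow> ?f k = 0"
    by (auto simp: fun_eq_iff)
  ultimately show "\<exists>f. (\<forall>k\<in>{0..<int M}. f k \<in> comp k) \<and> (\<forall>k. k \<notin> {0..<int M} \<longrightarrow> f k = 0) \<and>
      finite {k. f k \<noteq> 0} \<and> v = (\<Sum>k | f k \<noteq> 0. f k)"
    using restrict_sum[OF v] by (intro exI[of _ ?f]) blast
next
  fix v f g
  assume v: "v \<in> H"
  have eq: "f k i j = (if k \<in> {0..<int M} \<and> deg i j mod int M = k then v i j else 0)"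
    if f: "(\<forall>k\<in>{0..<int M}. f k \<in> comp k) \<and> (\<forall>k. k \<notin> {0..<int M} \<longrightarrow> f k = 0) \<and>
      finite {k. f k \<noteq> 0} \<and> v = (\<Sum>k | f k \<noteq> 0. f k)" for f :: "int \<Rightarrow> nat \<Rightarrow> nat \<Rightarrow> 'a" and k i j
  proof -
    have zero: "f k i j = 0" if "k \<notin> {0..<int M} \<or> deg i j mod int M \<noteq> k" for k
      using f that by (cases "k \<in> {0..<int M}") (fastforce simp: comp_def cong_def)+
    have "v i j = (\<Sum>k | f k \<noteq> 0. f k i j)"
      using f by (metis sum_fun_apply2)
    also have "\<dots> = (\<Sum>k | f k \<noteq> 0. if k = deg i j mod int M then f k i j else 0)"
      using zero by (intro sum.cong) auto
    also have "\<dots> = f (deg i j mod int M) i j"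
      using f by auto
    finally show ?thesis
      using zero by auto
  qed
  assume "(\<forall>k\<in>{0..<int M}. f k \<in> comp k) \<and> (\<forall>k. k \<notin> {0..<int M} \<longrightarrow> f k = 0) \<and>
      finite {k. f k \<noteq> 0} \<and> v = (\<Sum>k | f k \<noteq> 0. f k)"
    "(\<forall>k\<in>{0..<int M}. g k \<in> comp k) \<and> (\<forall>k. k \<notin> {0..<int M} \<longrightarrow> g k = 0) \<and>
      finite {k. g k \<noteq> 0} \<and> v = (\<Sum>k | g k \<noteq> 0. g k)"
  from eq[OF this(1)] eq[OF this(2)] show "f = g"
    by (intro ext) simp
qed

lemma cyclic_graded_comp: "cyclic_graded_lie_algebra dp_scale H br M comp"
proof unfold_locales
  show "comp j = comp k" if "[j = k] (mod int M)" for j k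
    using that by (rule comp_cong)
qed (simp_all add: M_pos direct_sum_comp comp_br)

lemma X_in_comp: "X \<in> comp 1" and Y_in_comp: "Y \<in> comp 1"
  using r_ge_3 q_ge_3 by (auto simp: X_def Y_def deg_def of_nat_diff intro!: monom_in_comp)

section \<open>Brackets with the generators\<close>

lemma dp_mult_0 [simp]: "dp_mult r q f 0 = 0" "dp_mult r q 0 f = 0"
  by (simp_all add: dp_mult_def fun_eq_iff)

lemma dp_mult_minus: "dp_mult r q f (- g) = - dp_mult r q f g"
  by (auto simp: dp_mult_def fun_eq_iff sum_negf)

lemma br_X: "\<lbrakk>i < r; j < q\<rbrakk> \<Longrightarrow> br (m i j) X = (if j = 0 then 0 else m i (j - 1))"
  using r_ge_3
  by (auto simp: br_def hamiltonian_bracket_def X_def dp_deriv1_monom dp_deriv2_monom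
      dp_mult_monom dp_mult_linear)

lemma br_Y:
  "br (m i j) Y = - dp_mult r q (dp_deriv1 (m i j)) (m 0 (q - 2))
     + dp_mult r q (m (r - 1) 0)
         (dp_mult r q (dp_deriv2 (m i j)) (m 0 (q - 1)) - dp_mult r q (m i j) (m 0 (q - 2)))"
proof -
  have "q - 1 - 1 = q - 2" by simp
  with q_ge_3 show ?thesis
    by (simp add: br_def hamiltonian_bracket_def Y_def dp_deriv1_monom dp_deriv2_monom
        del: One_nat_def)
qed

lemma br_Y_0:
  assumes "i < r"
  shows "br (m (nxt i) 0) Y = - m i (q - 2)"
proof (cases "Suc i = r")
  case True
  with q_ge_3 show ?thesis
    by (auto simp: br_Y nxt_def dp_deriv1_monom dp_deriv2_monom dp_mult_monom dp_mult_minus)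
next
  case False
  with assms q_ge_3 show ?thesis
    by (auto simp: br_Y nxt_def dp_deriv1_monom dp_deriv2_monom dp_mult_monom dp_mult_minus)
qed

text \<open>For \<open>nxt i \<noteq> 0\<close> the value comes from \<open>- \<partial>\<^sub>1 f \<partial>\<^sub>2 Y\<close>, with coefficient \<open>- (q - 1) = 1\<close>. For \<open>nxt i = 0\<close>
  it comes from \<open>x^(r - 1) (\<partial>\<^sub>2 f Y - f \<partial>\<^sub>2 Y)\<close>, whose two terms contribute \<open>1\<close> each.\<close>

lemma br_Y_1:
  assumes "i < r"
  shows "br (m (nxt i) 1) Y = dp_scale (if Suc i = r then 2 else 1) (m i (q - 1))"
proof -
  have "Suc (q - 2) = q - 1" using q_ge_3 by simp
  then have 1: "dp_mult r q (m k 1) (m 0 (q - 2)) = - m k (q - 1)" if "k < r" for k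
    using that q_ge_3 of_nat_q_minus_1 by (simp add: dp_mult_monom)
  show ?thesis
  proof (cases "Suc i = r")
    case True
    have "br (m (nxt i) 1) Y = dp_mult r q (m i 0) (m 0 (q - 1) + m 0 (q - 1))"
      using True q_ge_3 r_ge_3 1[of 0]
      by (auto simp: br_Y nxt_def dp_deriv1_monom dp_deriv2_monom dp_mult_monom)
    also have "m 0 (q - 1) + m 0 (q - 1) = dp_scale 2 (m 0 (q - 1))"
      by (simp add: dp_scale_def fun_eq_iff)
    finally show ?thesis
      using True assms q_ge_3 by (auto simp: dp_mult_linear dp_mult_monom)
  next
    case False
    with assms have "br (m (nxt i) 1) Y
        = m i (q - 1) + dp_mult r q (m (r - 1) 0) (m (Suc i) (q - 1) + m (Suc i) (q - 1))"
      using q_ge_3 r_ge_3 1[of i] 1[of "Suc i"]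
      by (auto simp: br_Y nxt_def dp_deriv1_monom dp_deriv2_monom dp_mult_monom[of _ _ _ 0 _ "q - 1"]
          simp del: One_nat_def)
    also have "\<dots> = m i (q - 1)"
      unfolding dp_mult_linear(2) using r_ge_3 by (simp add: dp_mult_monom)
    finally show ?thesis
      using False by simp
  qed
qed

lemma br_Y_ge_2: "\<lbrakk>i < r; 2 \<le> j; j < q\<rbrakk> \<Longrightarrow> br (m i j) Y = 0"
  by (auto simp: br_Y dp_deriv1_monom dp_deriv2_monom dp_mult_monom)


section \<open>The components of the grading\<close>

lemma deg_Suc: "deg i (Suc j) = deg i j - 1"
  by (simp add: deg_def)

lemma deg_nxt: "[deg (nxt i) 0 = deg i (q - 1)] (mod int M)" if "i < r"
proof (cases "Suc i = r")
  case True
  then have "deg i (q - 1) = deg (nxt i) 0 - int M"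
    using q_ge_3 by (auto simp: deg_def nxt_def M_def of_nat_diff algebra_simps)
  then show ?thesis by (simp add: cong_iff_dvd_diff)
next
  case False
  then show ?thesis
    using that q_ge_3 by (simp add: deg_def nxt_def of_nat_diff algebra_simps)
qed

lemma nxt_eq_iff: "\<lbrakk>i < r; k < r\<rbrakk> \<Longrightarrow> nxt i = nxt k \<longleftrightarrow> i = k"
  by (cases "Suc i = r"; cases "Suc k = r") (auto simp: nxt_def)

text \<open>For positive exponents of \<open>y\<close> the degree is a mixed-radix encoding of the exponents.\<close>

lemma deg_cong_iff_pos:
  assumes "i < r" "k < r" "0 < j" "j < q" "0 < l" "l < q"
  shows "[deg k l = deg i j] (mod int M) \<longleftrightarrow> k = i \<and> l = j"
proof
  assume cong: "[deg k l = deg i j] (mod int M)"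
  let ?c = "\<lambda>i j. (q - 1) * i + (j - 1)"
  have c: "deg i j = int (q - 1) - int (?c i j)" if j: "0 < j" for i j
  proof -
    obtain Q l where "q = Suc Q" "j = Suc l"
      using q_ge_3 j by (cases q; cases j) auto
    then show ?thesis unfolding deg_def by (simp add: algebra_simps)
  qed
  have less: "?c i j < M" if "i < r" "0 < j" "j < q" for i j
  proof -
    have "?c i j < (q - 1) * Suc i" using that by auto
    also have "\<dots> \<le> M" unfolding M_def using that by (intro mult_le_mono2) simp
    finally show ?thesis .
  qed
  have "deg k l - deg i j = int (?c i j) - int (?c k l)"
    unfolding c[OF assms(3)] c[OF assms(5)] by linarith
  with cong have "int M dvd int (?c i j) - int (?c k l)"
    unfolding cong_iff_dvd_diff by argo
  then have "[?c i j = ?c k l] (mod M)"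
    by (simp only: cong_iff_dvd_diff flip: cong_int_iff)
  then have "?c i j = ?c k l"
    using less assms by (meson cong_less_modulus_unique_nat)
  moreover have "?c i j div (q - 1) = i" "?c i j mod (q - 1) = j - 1" if "0 < j" "j < q" for i j
  proof -
    have "j - 1 < q - 1" using that by simp
    then show "?c i j div (q - 1) = i" "?c i j mod (q - 1) = j - 1"
      by (simp_all del: One_nat_def)
  qed
  ultimately have "i = k" "j - 1 = l - 1"
    using assms by metis+
  with assms show "k = i \<and> l = j" by simp
qed simp

text \<open>The exponents \<open>j = 0\<close> are the only source of coincidences: \<open>m (nxt i) 0\<close> shares its degree with
  \<open>m i (q - 1)\<close>, and these pairs are the diamonds.\<close>

lemma deg_cong_iff:
  assumes "i < r" "k < r" "0 < j" "j < q" "l < q"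
  shows "[deg k l = deg i j] (mod int M) \<longleftrightarrow> k = i \<and> l = j \<or> l = 0 \<and> j = q - 1 \<and> k = nxt i"
proof (cases "l = 0")
  case False
  with assms show ?thesis by (simp add: deg_cong_iff_pos)
next
  case True
  obtain k' where k': "k' < r" "k = nxt k'"
    using nxt_surj[OF assms(2)] by blast
  have "[deg k l = deg i j] (mod int M) \<longleftrightarrow> [deg k' (q - 1) = deg i j] (mod int M)"
    using deg_nxt[OF k'(1)] unfolding True k'(2) by (auto simp: cong_def)
  also have "\<dots> \<longleftrightarrow> k' = i \<and> q - 1 = j"
    using assms k' q_ge_3 by (intro deg_cong_iff_pos) auto
  finally show ?thesis
    using True assms(1,3) k' nxt_eq_iff by auto
qed

lemma degree_representative:
  obtains i j where "i < r" "0 < j" "j < q" "[deg i j = k] (mod int M)"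
proof -
  define c where "c = nat ((int q - 1 - k) mod int M)"
  have c: "int c = (int q - 1 - k) mod int M" and "c < M"
    using M_pos by (auto simp: c_def nat_less_iff)
  \<comment> \<open>In base \<open>q - 1\<close>, the lowest digit of \<open>q - 1 - k\<close> modulo \<open>M\<close> is \<open>j - 1\<close>, and the rest is \<open>i\<close>.\<close>
  define i j where "i = c div (q - 1)" and "j = c mod (q - 1) + 1"
  have "deg i j = int q - 1 - (int (q - 1) * int i + int (c mod (q - 1)))"
    using q_ge_3 by (simp add: deg_def j_def of_nat_diff algebra_simps)
  also have "int (q - 1) * int i + int (c mod (q - 1)) = int c"
    unfolding i_def by (metis mult_div_mod_eq of_nat_add of_nat_mult)
  finally have "[deg i j = int q - 1 - (int q - 1 - k)] (mod int M)"
    unfolding c by (simp only:) (intro cong_diff cong_refl cong_mod_left; simp)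
  moreover have "i < r"
    using \<open>c < M\<close> by (simp add: i_def M_def less_mult_imp_div_less mult.commute)
  moreover have "0 < j" by (simp add: j_def)
  moreover have "j < q"
  proof -
    have "c mod (q - 1) < q - 1" using q_ge_3 by simp
    then show ?thesis unfolding j_def by linarith
  qed
  ultimately show thesis
    using that by simp
qed

lemma comp_deg:
  assumes "i < r" "0 < j" "j < q" "f \<in> comp (deg i j)"
  shows "f = dp_scale (f i j) (m i j)
    + (if j = q - 1 then dp_scale (f (nxt i) 0) (m (nxt i) 0) else 0)" (is "f = ?g")
proof (intro ext)
  fix k l
  show "f k l = ?g k l"
  proof (cases "f k l = 0")
    case True
    then show ?thesis
      using assms(2) by (auto simp: dp_scale_def dp_monom_def)
  next
    case False
    then have "k < r" "l < q"
      using compD(1)[OF assms(4)] by (auto simp: H_iff not_less[symmetric])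
    with False have "k = i \<and> l = j \<or> l = 0 \<and> j = q - 1 \<and> k = nxt i"
      using compD(2)[OF assms(4) False] deg_cong_iff[OF assms(1) _ assms(2,3)] by blast
    then show ?thesis
      using assms(2) by (auto simp: dp_scale_def dp_monom_def)
  qed
qed

lemma comp_eq_span: "comp k = span {b \<in> monomials. b \<in> comp k}" (is "_ = span ?B")
proof
  show "span ?B \<subseteq> comp k"
    by (rule span_minimal) (auto simp: subspace_comp)
  show "comp k \<subseteq> span ?B"
  proof
    fix f
    assume f: "f \<in> comp k"
    show "f \<in> span ?B"
      by (rule in_subspace_if_monomials[OF compD(1)[OF f] subspace_span])
         (auto intro!: span_base monom_in_comp compD(2)[OF f] simp: monomials_def)
  qed
qed

lemma monom_in_comp_iff: "m i j \<in> comp k \<longleftrightarrow> i < r \<and> j < q \<and> [deg i j = k] (mod int M)"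
proof
  assume f: "m i j \<in> comp k"
  have "m i j i j \<noteq> 0" by (simp add: dp_monom_def)
  then show "i < r \<and> j < q \<and> [deg i j = k] (mod int M)"
    using compD(1)[OF f] compD(2)[OF f] by (auto simp: H_iff not_less[symmetric])
qed (auto intro: monom_in_comp)

lemma monomials_in_comp_deg:
  assumes "i < r" "0 < j" "j < q"
  shows "{b \<in> monomials. b \<in> comp (deg i j)} = (if j = q - 1 then {m i j, m (nxt i) 0} else {m i j})"
proof -
  have "{b \<in> monomials. b \<in> comp (deg i j)}
      = {m k l | k l. k < r \<and> l < q \<and> [deg k l = deg i j] (mod int M)}"
    by (auto simp: monomials_def monom_in_comp_iff monom_eq_iff)
  also have "\<dots> = {m k l | k l. k < r \<and> l < q \<and> (k = i \<and> l = j \<or> l = 0 \<and> j = q - 1 \<and> k = nxt i)}"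
    using deg_cong_iff[OF assms(1) _ assms(2,3)] by blast
  also have "\<dots> = (if j = q - 1 then {m i j, m (nxt i) 0} else {m i j})"
    using assms by (auto simp: monom_eq_iff)
  finally show ?thesis .
qed

lemma deg_0_last: "deg 0 (q - 1) = 1"
  using q_ge_3 by (simp add: deg_def of_nat_diff)

lemma comp_1: "comp 1 = span {X, Y}"
proof -
  have "nxt 0 = 1" using r_ge_3 by (simp add: nxt_def)
  then show ?thesis
    using comp_eq_span[of 1] monomials_in_comp_deg[of 0 "q - 1"] r_ge_3 q_ge_3
    by (simp add: deg_0_last X_def Y_def insert_commute del: One_nat_def)
qed

lemma X_in_H: "X \<in> H" and Y_in_H: "Y \<in> H"
  using X_in_comp Y_in_comp compD(1) by blast+

text \<open>Each monomial of degree \<open>k + 1\<close> has a predecessor of degree \<open>k\<close>: \<open>m i j\<close> with \<open>j < q - 1\<close> is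
  the bracket of \<open>m i (j + 1)\<close> with \<open>X\<close>, and \<open>m i (q - 1)\<close> is, up to a factor \<open>1\<close> or \<open>2\<close>, the bracket
  of \<open>m (nxt i) 1\<close> with \<open>Y\<close>. The family \<open>W\<close> is indexed by naturals in order to apply to loop algebras as
  well as to cyclic gradings, where the index is reduced modulo \<open>M\<close>.\<close>

lemma comp_minimal:
  fixes W :: "nat \<Rightarrow> (nat \<Rightarrow> nat \<Rightarrow> 'a) set"
  assumes subsp: "\<And>k. k \<ge> 1 \<Longrightarrow> subspace (W k)" and XY: "X \<in> W 1" "Y \<in> W 1"
    and step: "\<And>k a. \<lbrakk>k \<ge> 1; a \<in> W k; a \<in> H\<rbrakk> \<Longrightarrow> br a X \<in> W (k + 1) \<and> br a Y \<in> W (k + 1)"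
    and k: "k \<ge> 1"
  shows "comp (int k) \<subseteq> W k"
proof -
  have monom: "m i j \<in> W k" if "i < r" "j < q" "[deg i j = int k] (mod int M)" for i j
    using k that
  proof (induction k arbitrary: i j rule: nat_induct_at_least)
    case base
    then have "[deg i j = deg 0 (q - 1)] (mod int M)"
      by (simp add: deg_0_last del: One_nat_def)
    moreover have "nxt 0 = 1"
      using r_ge_3 by (simp add: nxt_def)
    ultimately have "m i j = X \<or> m i j = Y"
      using base q_ge_3 r_ge_3 deg_cong_iff[of 0 i "q - 1" j] by (auto simp: X_def Y_def)
    then show ?case using XY by auto
  next
    case (Suc k)
    show ?case
    proof (cases "Suc j < q")
      case True
      have "[deg i (Suc j) = int (Suc k) - 1] (mod int M)"
        unfolding deg_Suc by (intro cong_diff Suc.prems cong_refl)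
      with Suc True have "m i (Suc j) \<in> W k" by simp
      from step[OF Suc.hyps this H_closed(8)[OF Suc.prems(1) True]] show ?thesis
        using br_X[OF Suc.prems(1) True] by simp
    next
      case False
      with Suc.prems have j: "j = q - 1" by simp
      have "[deg (nxt i) 0 - 1 = int (Suc k) - 1] (mod int M)"
        using cong_trans[OF deg_nxt[OF Suc.prems(1)] Suc.prems(3)[unfolded j]]
        by (intro cong_diff cong_refl)
      then have 1: "m (nxt i) 1 \<in> W k"
        using Suc.IH[of "nxt i" 1] q_ge_3 deg_Suc[of "nxt i" 0] by simp
      define c :: 'a where "c = (if Suc i = r then 2 else 1)"
      have "c \<noteq> 0" using two_nonzero by (simp add: c_def)
      have "dp_scale c (m i j) \<in> W (Suc k)"
        using step[OF Suc.hyps 1 H_closed(8)] q_ge_3 br_Y_1[OF Suc.prems(1)]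
        unfolding c_def j by simp
      then have "dp_scale (inverse c) (dp_scale c (m i j)) \<in> W (Suc k)"
        by (rule subspace_scale[OF subsp, rotated]) simp
      then show ?thesis using \<open>c \<noteq> 0\<close> by simp
    qed
  qed
  show ?thesis
  proof
    fix f
    assume f: "f \<in> comp (int k)"
    show "f \<in> W k"
      by (rule in_subspace_if_monomials[OF compD(1)[OF f] subsp[OF k]])
         (auto intro: monom compD(2)[OF f])
  qed
qed

lemma comp_pos: obtains n where "n \<ge> 1" "comp k = comp (int n)"
proof (rule that)
  let ?n = "nat (k mod int M) + M"
  show "?n \<ge> 1" using M_pos by simp
  have "[k = int ?n] (mod int M)" using M_pos by (simp add: cong_def)
  then show "comp k = comp (int ?n)" by (rule comp_cong)
qed

lemma generated_XY: "generated {X, Y} = H"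
proof
  let ?G = "generated {X, Y}"
  show "?G \<subseteq> H"
    using X_in_H Y_in_H by (intro generated_minimal subalgebra_carrier) auto
  have G: "subalgebra ?G"
    using X_in_H Y_in_H by (intro subalgebra_generated) auto
  have XY: "X \<in> ?G" "Y \<in> ?G"
    using generated_superset[of "{X, Y}"] by auto
  show "H \<subseteq> ?G"
  proof
    fix f
    assume f: "f \<in> H"
    show "f \<in> ?G"
    proof (rule in_subspace_if_monomials[OF f])
      show "subspace ?G" using G by (simp add: subalgebra_def)
      fix i j
      assume ij: "i < r" "j < q"
      obtain n where n: "n \<ge> 1" "comp (deg i j) = comp (int n)"
        using comp_pos by blast
      have "comp (int n) \<subseteq> ?G"
        by (rule comp_minimal[where W = "\<lambda>_. ?G", OF _ _ _ _ n(1)])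
           (use G XY in \<open>auto simp: subalgebra_def\<close>)
      then show "m i j \<in> ?G"
        using monom_in_comp[OF ij, of "deg i j"] n(2) by auto
    qed
  qed
qed

text \<open>By minimality \<open>C k\<close> contains \<open>comp k\<close>. Both families are direct sum decompositions of \<open>H\<close>, so the
  decomposition along \<open>comp\<close> of an element of \<open>C k\<close> is also its decomposition along \<open>C\<close>, and hence
  has a single summand.\<close>

lemma grading_unique:
  assumes C: "cyclic_graded_lie_algebra dp_scale H br M C" and XY: "X \<in> C 1" "Y \<in> C 1"
  shows "C = comp"
proof -
  interpret C: cyclic_graded_lie_algebra dp_scale H br M C by (rule C)
  have C_sub: "subspace (C k) \<and> C k \<subseteq> H" for k
  proof -
    have "C k = C (k mod int M)"
      by (rule C.component_cong) (simp add: cong_def)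
    moreover have "k mod int M \<in> {0..<int M}"
      using M_pos by simp
    ultimately show ?thesis
      using C.direct_sum_components unfolding direct_sum_def by metis
  qed
  have sub: "comp k \<subseteq> C k" for k
  proof -
    obtain n where n: "n \<ge> 1" "[k = int n] (mod int M)"
    proof (rule that)
      let ?n = "nat (k mod int M) + M"
      show "?n \<ge> 1" using M_pos by simp
      show "[k = int ?n] (mod int M)" using M_pos by (simp add: cong_def)
    qed
    have "comp (int n) \<subseteq> C (int n)"
    proof (rule comp_minimal[where W = "\<lambda>n. C (int n)", OF _ _ _ _ n(1)])
      show "br a X \<in> C (int (k + 1)) \<and> br a Y \<in> C (int (k + 1))" if "a \<in> C (int k)" for k a
        using C.bracket_component[OF that XY(1)] C.bracket_component[OF that XY(2)]
        by (simp add: algebra_simps)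
    qed (use XY C_sub in auto)
    then show ?thesis
      using comp_cong[OF n(2)] C.component_cong[OF n(2)] by simp
  qed
  have "C k \<subseteq> comp k" for k
  proof
    fix v
    assume v: "v \<in> C k"
    then have vH: "v \<in> H" using C_sub by blast
    define k' where "k' = k mod int M"
    have k': "k' \<in> {0..<int M}" and cong: "[k = k'] (mod int M)"
      using M_pos by (auto simp: k'_def cong_def)
    obtain f where f: "\<forall>k\<in>{0..<int M}. f k \<in> comp k" "\<forall>k. k \<notin> {0..<int M} \<longrightarrow> f k = 0"
      "finite {k. f k \<noteq> 0}" "v = (\<Sum>k | f k \<noteq> 0. f k)"
      using direct_sum_comp vH unfolding direct_sum_def by metis
    define g where "g = (\<lambda>l. if l = k' then v else 0)"
    have g: "\<forall>k\<in>{0..<int M}. g k \<in> C k" "\<forall>k. k \<notin> {0..<int M} \<longrightarrow> g k = 0"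
      "finite {k. g k \<noteq> 0}" "v = (\<Sum>k | g k \<noteq> 0. g k)"
    proof -
      show "\<forall>k\<in>{0..<int M}. g k \<in> C k"
        using v C.component_cong[OF cong] C_sub subspace_0 by (auto simp: g_def)
      have supp: "{k. g k \<noteq> 0} = (if v = 0 then {} else {k'})"
        by (auto simp: g_def)
      show "finite {k. g k \<noteq> 0}" "v = (\<Sum>k | g k \<noteq> 0. g k)"
        unfolding supp by (auto simp: g_def)
    qed (use k' in \<open>auto simp: g_def\<close>)
    have "\<exists>!f. (\<forall>k\<in>{0..<int M}. f k \<in> C k) \<and> (\<forall>k. k \<notin> {0..<int M} \<longrightarrow> f k = 0) \<and>
        finite {k. f k \<noteq> 0} \<and> v = (\<Sum>k | f k \<noteq> 0. f k)"
      using C.direct_sum_components vH unfolding direct_sum_def by blast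
    moreover have "\<forall>k\<in>{0..<int M}. f k \<in> C k"
      using f(1) sub by blast
    ultimately have "f = g"
      using f g by blast
    then have "v = f k'" by (simp add: g_def)
    then show "v \<in> comp k"
      using f(1) k' comp_cong[OF cong] by blast
  qed
  with sub show ?thesis by (intro ext) blast
qed

text \<open>Three cases according to the exponent \<open>j\<close> of \<open>y\<close> in degree \<open>k\<close>. Leaving a diamond (\<open>j = q - 1\<close>), the
  brackets with \<open>X\<close> and \<open>Y\<close> detect the two coordinates of \<open>v\<close>. Between diamonds \<open>X\<close> alone suffices.
  Entering a diamond (\<open>j = 1\<close>), \<open>X\<close> and \<open>Y\<close> reach its two basis monomials, which needs \<open>2 \<noteq> 0\<close>.\<close>

lemma covering_H:
  assumes v: "v \<in> comp k" "v \<noteq> 0"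
  shows "comp (k + 1) = br v ` comp 1"
proof
  show "br v ` comp 1 \<subseteq> comp (k + 1)"
    using comp_br[OF v(1)] by blast
  have vH: "v \<in> H" using v(1) compD by blast
  have image: "dp_scale a (br v X) + dp_scale b (br v Y) \<in> br v ` comp 1" for a b
  proof (rule image_eqI)
    show "dp_scale a X + dp_scale b Y \<in> comp 1"
      by (intro subspace_add subspace_scale subspace_comp X_in_comp Y_in_comp)
    show "dp_scale a (br v X) + dp_scale b (br v Y) = br v (dp_scale a X + dp_scale b Y)"
      by (simp add: bracket_add_right bracket_scale_right vH X_in_H Y_in_H H_closed)
  qed
  show "comp (k + 1) \<subseteq> br v ` comp 1"
  proof
    fix w
    assume w: "w \<in> comp (k + 1)"
    obtain i j where ij: "i < r" "0 < j" "j < q" and deg: "[deg i j = k] (mod int M)"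
      using degree_representative .
    define \<alpha> \<beta> where "\<alpha> = v i j" and "\<beta> = v (nxt i) 0"
    have v_eq: "v = dp_scale \<alpha> (m i j) + (if j = q - 1 then dp_scale \<beta> (m (nxt i) 0) else 0)"
      using comp_deg[OF ij] v(1) comp_cong[OF deg] unfolding \<alpha>_def \<beta>_def by blast
    have mH: "m i j \<in> H" "m (nxt i) 0 \<in> H"
      using ij q_ge_3 by (auto simp: H_closed)
    have deg': "[deg i (j - 1) = k + 1] (mod int M)"
      using cong_add[OF deg cong_refl, of 1] ij deg_Suc[of i "j - 1"] by simp
    consider "j = q - 1" | "j < q - 1" "2 \<le> j" | "j < q - 1" "j = 1"
      using ij by linarith
    then show "w \<in> br v ` comp 1"
    proof cases
      case 1
      have X: "br v X = dp_scale \<alpha> (m i (q - 2))"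
        using 1 ij q_ge_3 mH br_X[of i j] br_X[of "nxt i" 0] unfolding v_eq
        by (simp add: bracket_add_left bracket_scale_left X_in_H H_closed diff_diff_add numeral_2_eq_2)
      have Y: "br v Y = dp_scale (- \<beta>) (m i (q - 2))"
        using 1 ij q_ge_3 mH br_Y_ge_2[of i j] br_Y_0[of i] unfolding v_eq
        by (simp add: bracket_add_left bracket_scale_left Y_in_H H_closed)
      obtain \<gamma> where w_eq: "w = dp_scale \<gamma> (m i (q - 2))"
        using comp_deg[of i "j - 1" w] w comp_cong[OF deg'] 1 ij q_ge_3
        by (auto simp: diff_diff_add numeral_2_eq_2 split: if_splits)
      have "\<alpha> \<noteq> 0 \<or> \<beta> \<noteq> 0"
        using v(2) v_eq by (auto split: if_splits)
      then show ?thesis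
      proof
        assume "\<alpha> \<noteq> 0"
        then show ?thesis
          using image[of "\<gamma> / \<alpha>" 0] by (simp add: X Y w_eq)
      next
        assume "\<beta> \<noteq> 0"
        then show ?thesis
          using image[of 0 "- \<gamma> / \<beta>"] by (simp add: X Y w_eq)
      qed
    next
      case 2
      then have "\<alpha> \<noteq> 0" using v(2) v_eq by auto
      have X: "br v X = dp_scale \<alpha> (m i (j - 1))"
        using 2 ij mH br_X[of i j] unfolding v_eq by (simp add: bracket_scale_left X_in_H)
      have "0 < j - 1" "j - 1 < q" "j - 1 \<noteq> q - 1"
        using 2 by auto
      then obtain \<gamma> where "w = dp_scale \<gamma> (m i (j - 1))"
        using comp_deg[of i "j - 1" w] w comp_cong[OF deg'] ij(1) by auto
      then show ?thesis
        using image[of "\<gamma> / \<alpha>" 0] \<open>\<alpha> \<noteq> 0\<close> by (simp add: X)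
    next
      case 3
      then have "\<alpha> \<noteq> 0" using v(2) v_eq by auto
      obtain i' where i': "i' < r" "i = nxt i'" using nxt_surj[OF ij(1)] by blast
      define c :: 'a where "c = (if Suc i' = r then 2 else 1)"
      have "c \<noteq> 0" using two_nonzero by (simp add: c_def)
      have X: "br v X = dp_scale \<alpha> (m i 0)"
        using 3 ij mH br_X[of i j] unfolding v_eq by (simp add: bracket_scale_left X_in_H)
      have Y: "br v Y = dp_scale (\<alpha> * c) (m i' (q - 1))"
        using 3 ij mH br_Y_1[of i'] i' unfolding v_eq
        by (simp add: bracket_scale_left Y_in_H c_def)
      have "[k + 1 = deg i' (q - 1)] (mod int M)"
        using cong_trans[OF cong_sym[OF deg'], of "deg i' (q - 1)"] deg_nxt[OF i'(1)] 3 i' by simp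
      then obtain \<gamma> \<delta> where "w = dp_scale \<gamma> (m i' (q - 1)) + dp_scale \<delta> (m i 0)"
        using comp_deg[of i' "q - 1" w] w comp_cong i' q_ge_3 by auto
      then show ?thesis
        using image[of "\<delta> / \<alpha>" "\<gamma> / (\<alpha> * c)"] \<open>\<alpha> \<noteq> 0\<close> \<open>c \<noteq> 0\<close> by (simp add: X Y add.commute)
    qed
  qed
qed


section \<open>The loop algebra\<close>

abbreviation tscale :: "'a \<Rightarrow> (nat \<Rightarrow> nat \<Rightarrow> 'a) poly \<Rightarrow> (nat \<Rightarrow> nat \<Rightarrow> 'a) poly" where
  "tscale \<equiv> tensor_scale dp_scale"

sublocale T: lie_algebra tscale "tensor_carrier H" "tensor_bracket br"
  by (rule lie_algebra_tensor)

definition N :: "(nat \<Rightarrow> nat \<Rightarrow> 'a) poly set" where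
  "N = loop_algebra dp_scale H br comp"

definition Nc :: "nat \<Rightarrow> (nat \<Rightarrow> nat \<Rightarrow> 'a) poly set" where
  "Nc = loop_component dp_scale H br comp"

lemma comp_subset: "comp k \<subseteq> H"
  using compD by blast

lemma N_generated: "N = T.generated ((\<lambda>s. monom s 1) ` comp 1)"
  by (simp add: N_def loop_algebra_def)

lemma generators_in_tensor: "(\<lambda>s. monom s 1) ` comp 1 \<subseteq> tensor_carrier H"
  using comp_subset by (auto intro: tensor_carrier_monom)

lemma subalgebra_N: "T.subalgebra N"
  unfolding N_generated by (rule T.subalgebra_generated[OF generators_in_tensor])

lemma subspace_N: "T.subspace N"
  using subalgebra_N by (simp add: T.subalgebra_def)

lemma bracket_in_N: "\<lbrakk>P \<in> N; Q \<in> N\<rbrakk> \<Longrightarrow> tensor_bracket br P Q \<in> N"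
  using subalgebra_N by (simp add: T.subalgebra_def)

text \<open>The expected loop algebra: the sum of all \<open>comp k \<otimes> t^k\<close> with \<open>k \<ge> 1\<close>; it is shown to equal \<open>N\<close>.\<close>

definition homogeneous_loops :: "(nat \<Rightarrow> nat \<Rightarrow> 'a) poly set" where
  "homogeneous_loops = {P. coeff P 0 = 0 \<and> (\<forall>k\<ge>1. coeff P k \<in> comp (int k))}"

lemma homogeneous_loops_tensor: "homogeneous_loops \<subseteq> tensor_carrier H"
proof
  fix P
  assume P: "P \<in> homogeneous_loops"
  have "coeff P k \<in> H" for k
    using P comp_subset[of "int k"]
    by (cases "k = 0") (auto simp: homogeneous_loops_def H_closed Suc_le_eq)
  then show "P \<in> tensor_carrier H" by (simp add: tensor_carrier_def)
qed

lemma subspace_homogeneous_loops: "T.subspace homogeneous_loops"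
  by (rule T.subspaceI)
     (auto simp: homogeneous_loops_def intro: subspace_0 subspace_add subspace_scale subspace_comp)

lemma monom_homogeneous: "\<lbrakk>k \<ge> 1; v \<in> comp (int k)\<rbrakk> \<Longrightarrow> monom v k \<in> homogeneous_loops"
  by (auto simp: homogeneous_loops_def intro: subspace_0 subspace_comp)

lemma subalgebra_homogeneous_loops: "T.subalgebra homogeneous_loops"
  unfolding T.subalgebra_def
proof (intro conjI ballI)
  fix P Q
  assume P: "P \<in> homogeneous_loops" and Q: "Q \<in> homogeneous_loops"
  have "monom (br (coeff P i) (coeff Q j)) (i + j) \<in> homogeneous_loops" for i j
  proof (cases "i = 0 \<or> j = 0")
    case True
    have "coeff P i \<in> H" "coeff Q j \<in> H"
      using P Q homogeneous_loops_tensor by (auto simp: tensor_carrier_def)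
    with True P Q have "br (coeff P i) (coeff Q j) = 0"
      using bracket_zero by (auto simp: homogeneous_loops_def)
    then show ?thesis
      using T.subspace_0[OF subspace_homogeneous_loops] by simp
  next
    case False
    with P Q have "br (coeff P i) (coeff Q j) \<in> comp (int (i + j))"
      using comp_br[of _ "int i" _ "int j"] by (auto simp: homogeneous_loops_def)
    with False show ?thesis by (intro monom_homogeneous) auto
  qed
  then show "tensor_bracket br P Q \<in> homogeneous_loops"
    unfolding tensor_bracket_def by (intro T.subspace_sum subspace_homogeneous_loops)
qed (rule homogeneous_loops_tensor, rule subspace_homogeneous_loops)

lemma monom_in_N:
  assumes "k \<ge> 1" "v \<in> comp (int k)"
  shows "monom v k \<in> N"
proof -
  have gen: "monom s 1 \<in> N" if "s \<in> comp 1" for s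
    using T.generated_superset[of "(\<lambda>s. monom s 1) ` comp 1"] that by (auto simp: N_generated)
  have "comp (int k) \<subseteq> {v. monom v k \<in> N}"
  proof (rule comp_minimal[OF _ _ _ _ assms(1)])
    show "subspace {v. monom v k \<in> N}" for k
      using T.subspace_0[OF subspace_N] T.subspace_add[OF subspace_N] T.subspace_scale[OF subspace_N]
      by (intro subspaceI) (auto simp: add_monom[symmetric] tensor_scale_monom[symmetric])
    show "X \<in> {v. monom v 1 \<in> N}" "Y \<in> {v. monom v 1 \<in> N}"
      using gen X_in_comp Y_in_comp by auto
    fix k a
    assume "a \<in> {v. monom v k \<in> N}" and a: "a \<in> H"
    then have "tensor_bracket br (monom a k) (monom A 1) \<in> N" if "A \<in> comp 1" for A
      using bracket_in_N[OF _ gen[OF that]] by blast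
    from this[OF X_in_comp] this[OF Y_in_comp]
    show "br a X \<in> {v. monom v (k + 1) \<in> N} \<and> br a Y \<in> {v. monom v (k + 1) \<in> N}"
      unfolding tensor_bracket_monom[OF a X_in_H] tensor_bracket_monom[OF a Y_in_H] by blast
  qed
  with assms(2) show ?thesis by auto
qed

lemma N_eq: "N = homogeneous_loops"
proof
  show "N \<subseteq> homogeneous_loops"
    unfolding N_generated
    by (rule T.generated_minimal[OF _ subalgebra_homogeneous_loops])
       (use monom_homogeneous[of 1] in auto)
  show "homogeneous_loops \<subseteq> N"
  proof
    fix P
    assume P: "P \<in> homogeneous_loops"
    have "monom (coeff P k) k \<in> N" for k
      using P monom_in_N[of k "coeff P k"] T.subspace_0[OF subspace_N]
      by (cases "k = 0") (auto simp: homogeneous_loops_def)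
    then have "(\<Sum>k\<le>degree P. monom (coeff P k) k) \<in> N"
      by (intro T.subspace_sum subspace_N)
    then show "P \<in> N" by (simp add: poly_as_sum_of_monoms)
  qed
qed

lemma Nc_eq:
  assumes "k \<ge> 1"
  shows "Nc k = (\<lambda>v. monom v k) ` comp (int k)"
proof -
  have "monom v k \<in> N \<longleftrightarrow> v \<in> comp (int k)" for v
  proof
    assume "monom v k \<in> N"
    then have "coeff (monom v k) k \<in> comp (int k)"
      using assms unfolding N_eq homogeneous_loops_def by blast
    then show "v \<in> comp (int k)" by simp
  qed (rule monom_in_N[OF assms])
  then show ?thesis
    unfolding Nc_def loop_component_def N_def[symmetric] by blast
qed

lemma module_hom_monom: "module_hom dp_scale tscale (\<lambda>v. monom v k)"
proof (intro module_hom.intro module_hom_axioms.intro)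
  show "module dp_scale" by (simp add: module_iff_vector_space vector_space_dp_scale)
  show "module tscale" by (rule T.module_axioms)
  show "monom (b1 + b2) k = monom b1 k + monom b2 k" for b1 b2 :: "nat \<Rightarrow> nat \<Rightarrow> 'a"
    by (rule add_monom[symmetric])
  show "monom (dp_scale c b) k = tscale c (monom b k)" for c b
    by (rule tensor_scale_monom[symmetric])
qed

lemma Nc_eq_span:
  assumes "k \<ge> 1"
  shows "Nc k = T.span ((\<lambda>v. monom v k) ` {b \<in> monomials. b \<in> comp (int k)})"
  unfolding Nc_eq[OF assms] module_hom.span_image[OF module_hom_monom] comp_eq_span[symmetric] ..

lemma inj_monom: "inj_on (\<lambda>v. monom v k) A"
  by (simp add: inj_on_def)

lemma dim_Nc:
  assumes "k \<ge> 1"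
  shows "T.dim (Nc k) = card {b \<in> monomials. b \<in> comp (int k)}"
proof -
  have "independent {b \<in> monomials. b \<in> comp (int k)}"
    by (rule independent_mono[OF independent_monomials]) auto
  then have "T.independent ((\<lambda>v. monom v k) ` {b \<in> monomials. b \<in> comp (int k)})"
    by (rule module_hom.independent_injective_image[OF module_hom_monom _ inj_monom])
  from T.dim_span_eq_card_independent[OF this] show ?thesis
    by (simp only: Nc_eq_span[OF assms] card_image[OF inj_monom])
qed

lemma dim_Nc_deg:
  assumes "k \<ge> 1" "i < r" "0 < j" "j < q" "[deg i j = int k] (mod int M)"
  shows "T.dim (Nc k) = (if j = q - 1 then 2 else 1)"
proof -
  have "{b \<in> monomials. b \<in> comp (int k)} = (if j = q - 1 then {m i j, m (nxt i) 0} else {m i j})"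
    using monomials_in_comp_deg[OF assms(2-4)] comp_cong[OF assms(5)] by simp
  with assms(3) show ?thesis
    unfolding dim_Nc[OF assms(1)] by (auto simp: monom_eq_iff)
qed

lemma dim_Nc_eq_2_iff:
  assumes "k \<ge> 1"
  shows "T.dim (Nc k) = 2 \<longleftrightarrow> [k = 1] (mod (q - 1))"
proof -
  obtain i j where ij: "i < r" "0 < j" "j < q" and deg: "[deg i j = int k] (mod int M)"
    using degree_representative .
  have "int (q - 1) dvd int M"
    by (simp add: M_def del: of_nat_diff)
  with deg have "[deg i j = int k] (mod int (q - 1))"
    unfolding cong_iff_dvd_diff by (rule dvd_trans[rotated])
  moreover have "deg i j = int (q - 1 - j) + 1 + int (q - 1) * (- int i)"
    using ij q_ge_3 by (simp add: deg_def of_nat_diff algebra_simps)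
  ultimately have "[int k = int (q - 1 - j) + 1] (mod int (q - 1))"
    unfolding cong_def by (metis mod_mult_self2)
  then have "[int k = int 1] (mod int (q - 1)) \<longleftrightarrow> [int (q - 1 - j) + 1 = int 1] (mod int (q - 1))"
    by (simp only: cong_def)
  also have "\<dots> \<longleftrightarrow> int (q - 1) dvd int (q - 1 - j)"
    by (simp add: cong_iff_dvd_diff)
  also have "\<dots> \<longleftrightarrow> j = q - 1"
  proof -
    have "q - 1 dvd q - 1 - j \<longleftrightarrow> q - 1 - j = 0"
      using ij by (auto dest: dvd_imp_le)
    then show ?thesis
      using ij unfolding int_dvd_int_iff by auto
  qed
  finally have "[k = 1] (mod (q - 1)) \<longleftrightarrow> j = q - 1"
    unfolding cong_int_iff .
  then show ?thesis
    unfolding dim_Nc_deg[OF assms ij deg] by simp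
qed

lemma bracket_Nc:
  "\<lbrakk>v \<in> comp j; w \<in> comp k\<rbrakk> \<Longrightarrow> tensor_bracket br (monom v a) (monom w b) = monom (br v w) (a + b)"
  using comp_subset by (intro tensor_bracket_monom) auto

lemma lie_algebra_N: "lie_algebra tscale N (tensor_bracket br)"
  by (rule T.lie_algebra_subalgebra[OF subalgebra_N])

lemma direct_sum_Nc: "lie_algebra.direct_sum tscale N {1..} Nc"
proof -
  interpret N: lie_algebra tscale N "tensor_bracket br" by (rule lie_algebra_N)
  show ?thesis
    unfolding N.direct_sum_def
  proof (intro conjI ballI ex_ex1I)
    fix k :: nat
    assume "k \<in> {1..}"
    then show "T.subspace (Nc k)" by (simp add: Nc_eq_span)
    show "Nc k \<subseteq> N" by (auto simp: Nc_def loop_component_def N_def)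
  next
    fix P
    assume P: "P \<in> N"
    \<comment> \<open>The entry at \<open>k = 0\<close> is zero because elements of \<open>N\<close> have no constant term.\<close>
    let ?f = "\<lambda>k. monom (coeff P k) k"
    have sub: "{k. ?f k \<noteq> 0} \<subseteq> {..degree P}"
      by (auto simp: le_degree)
    have "P = (\<Sum>k\<le>degree P. ?f k)"
      by (simp add: poly_as_sum_of_monoms)
    also have "\<dots> = (\<Sum>k | ?f k \<noteq> 0. ?f k)"
      by (rule sum.mono_neutral_right[OF _ sub]) auto
    finally have "P = (\<Sum>k | ?f k \<noteq> 0. ?f k)" .
    moreover have "finite {k. ?f k \<noteq> 0}"
      using finite_subset[OF sub] by blast
    moreover have "\<forall>k\<in>{1..}. ?f k \<in> Nc k" "\<forall>k. k \<notin> {1..} \<longrightarrow> ?f k = 0"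
      using P by (auto simp: N_eq homogeneous_loops_def Nc_eq not_le)
    ultimately show "\<exists>f. (\<forall>k\<in>{1..}. f k \<in> Nc k) \<and> (\<forall>k. k \<notin> {1..} \<longrightarrow> f k = 0) \<and>
        finite {k. f k \<noteq> 0} \<and> P = (\<Sum>k | f k \<noteq> 0. f k)"
      by (intro exI[of _ ?f]) blast
  next
    fix P f g
    have eq: "f n = monom (coeff P n) n"
      if f: "(\<forall>k\<in>{1..}. f k \<in> Nc k) \<and> (\<forall>k. k \<notin> {1..} \<longrightarrow> f k = 0) \<and>
        finite {k. f k \<noteq> 0} \<and> P = (\<Sum>k | f k \<noteq> 0. f k)" for f and n :: nat
    proof -
      have single: "f k = monom (coeff (f k) k) k" for k
      proof (cases "k \<ge> 1")
        case True
        with f have "f k \<in> Nc k" by simp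
        with True show ?thesis by (auto simp: Nc_eq)
      qed (use f in simp)
      then have zero: "coeff (f k) n = 0" if "k \<noteq> n" for k n
        using that by (metis coeff_monom)
      have "coeff P n = (\<Sum>k | f k \<noteq> 0. coeff (f k) n)"
        using f by (metis coeff_sum)
      also have "\<dots> = (\<Sum>k | f k \<noteq> 0. if k = n then coeff (f n) n else 0)"
        using zero by (intro sum.cong) auto
      also have "\<dots> = coeff (f n) n"
        using f by auto
      finally show ?thesis using single by metis
    qed
    assume "(\<forall>k\<in>{1..}. f k \<in> Nc k) \<and> (\<forall>k. k \<notin> {1..} \<longrightarrow> f k = 0) \<and>
        finite {k. f k \<noteq> 0} \<and> P = (\<Sum>k | f k \<noteq> 0. f k)"
      "(\<forall>k\<in>{1..}. g k \<in> Nc k) \<and> (\<forall>k. k \<notin> {1..} \<longrightarrow> g k = 0) \<and>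
        finite {k. g k \<noteq> 0} \<and> P = (\<Sum>k | g k \<noteq> 0. g k)"
    from eq[OF this(1)] eq[OF this(2)] show "f = g"
      by (intro ext) simp
  qed
qed

text \<open>A finite set bounds the degree in \<open>t\<close> on its span, but every component \<open>Nc k\<close> with \<open>k \<ge> 1\<close>
  contains a monomial.\<close>

lemma not_finitely_spanned: "\<not> (\<exists>B. finite B \<and> T.span B = N)"
proof
  assume "\<exists>B. finite B \<and> T.span B = N"
  then obtain B where B: "finite B" "T.span B = N" by blast
  define d where "d = Max (insert 0 (degree ` B))"
  have "T.subspace {P. degree P \<le> d}"
  proof (rule T.subspaceI)
    show "tscale c P \<in> {P. degree P \<le> d}" if "P \<in> {P. degree P \<le> d}" for c P
      using that by (auto intro!: degree_le simp: coeff_eq_0)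
  qed (auto intro: degree_add_le)
  moreover have "B \<subseteq> {P. degree P \<le> d}"
    using B(1) by (auto simp: d_def)
  ultimately have bound: "N \<subseteq> {P. degree P \<le> d}"
    unfolding B(2)[symmetric] by (rule T.span_minimal[rotated])
  obtain i j where ij: "i < r" "0 < j" "j < q" and deg: "[deg i j = int (Suc d)] (mod int M)"
    using degree_representative .
  have "monom (m i j) (Suc d) \<in> N"
    by (rule monom_in_N) (use ij deg in \<open>auto intro: monom_in_comp simp del: of_nat_Suc\<close>)
  moreover have "m i j \<noteq> 0"
    by (auto simp: dp_monom_def fun_eq_iff)
  ultimately show False
    using bound by (auto simp: degree_monom_eq)
qed

lemma q_cong_1: "[q = 1] (mod (q - 1))"
proof -
  have "[(q - 1) + 1 = 0 + 1] (mod (q - 1))"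
    by (intro cong_add) (simp_all add: cong_def)
  then show ?thesis using q_ge_3 by simp
qed

lemma thin_N: "thin_lie_algebra tscale N (tensor_bracket br) Nc"
proof -
  interpret N: lie_algebra tscale N "tensor_bracket br" by (rule lie_algebra_N)
  show ?thesis
  proof unfold_locales
    show "N.direct_sum {1..} Nc" by (rule direct_sum_Nc)
    show "tensor_bracket br P Q \<in> Nc (i + j)" if ij: "i \<ge> 1" "j \<ge> 1" and PQ: "P \<in> Nc i" "Q \<in> Nc j" for i j P Q
    proof -
      obtain v w where "v \<in> comp (int i)" "w \<in> comp (int j)" "P = monom v i" "Q = monom w j"
        using PQ unfolding Nc_eq[OF ij(1)] Nc_eq[OF ij(2)] by blast
      then show ?thesis
        using ij(1) comp_br[of v "int i" w "int j"] by (auto simp: bracket_Nc Nc_eq)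
    qed
    show "T.dim (Nc 1) = 2"
      by (simp add: dim_Nc_eq_2_iff)
    show "\<exists>i>1. T.dim (Nc i) = 2"
      using q_ge_3 q_cong_1 by (intro exI[of _ q]) (auto simp: dim_Nc_eq_2_iff)
    show "Nc (i + 1) = tensor_bracket br u ` Nc 1" if i: "i \<ge> 1" and u: "u \<in> Nc i" "u \<noteq> 0" for i u
    proof -
      obtain v where v: "v \<in> comp (int i)" "u = monom v i"
        using u(1) unfolding Nc_eq[OF i] by blast
      with u(2) have "comp (int i + 1) = br v ` comp 1"
        by (intro covering_H) auto
      then have "Nc (i + 1) = (\<lambda>w. monom (br v w) (i + 1)) ` comp 1"
        by (simp add: Nc_eq image_image add.commute)
      also have "\<dots> = tensor_bracket br u ` Nc 1"
        using v by (simp add: Nc_eq image_image bracket_Nc)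
      finally show ?thesis .
    qed
    show "\<not> (\<exists>B. finite B \<and> T.span B = N)" by (rule not_finitely_spanned)
  qed
qed

sublocale N: thin_lie_algebra tscale N "tensor_bracket br" Nc
  by (rule thin_N)

lemma diamond_iff: "i \<ge> 1 \<Longrightarrow> N.diamond i \<longleftrightarrow> [i = 1] (mod (q - 1))"
  by (simp add: N.diamond_def dim_Nc_eq_2_iff)

lemma second_diamond_q: "N.second_diamond q"
proof -
  have "\<not> [i = 1] (mod (q - 1))" if i: "1 < i" "i < q" for i
  proof
    assume "[i = 1] (mod (q - 1))"
    then have "[i - 1 = 0] (mod (q - 1))"
      using i cong_diff_nat[of i 1 "q - 1" 1 1] by simp
    moreover have "i - 1 < q - 1" "0 < q - 1"
      using i by linarith+
    ultimately have "i - 1 = 0"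
      by (rule cong_less_modulus_unique_nat)
    with i show False by simp
  qed
  then show ?thesis
    using q_ge_3 q_cong_1 by (auto simp: N.second_diamond_def diamond_iff)
qed

section \<open>Diamond types\<close>

text \<open>The component below a diamond is spanned by \<open>m (nxt i) 1\<close>. The number \<open>c\<close> decides the type: \<open>c = 1\<close> gives
  type \<open>\<infinity>\<close>, whereas \<open>c = 2\<close> gives the relation \<open>1 - \<mu> = - 2 \<mu>\<close>, that is, \<open>\<mu> = - 1\<close>.\<close>

lemma brackets_below_diamond:
  assumes "i < r"
  defines "c \<equiv> (if Suc i = r then 2 else 1)"
  shows "br (br (m (nxt i) 1) X) X = 0" "br (br (m (nxt i) 1) Y) Y = 0"
    "br (br (m (nxt i) 1) X) Y = - m i (q - 2)"
    "br (br (m (nxt i) 1) Y) X = dp_scale c (m i (q - 2))"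
proof -
  have H: "m i (q - 1) \<in> H"
    using assms q_ge_3 by (simp add: H_closed)
  have X: "br (m (nxt i) 1) X = m (nxt i) 0"
    using br_X[of "nxt i" 1] q_ge_3 by simp
  have Y: "br (m (nxt i) 1) Y = dp_scale c (m i (q - 1))"
    using br_Y_1[OF assms(1)] by (simp add: c_def)
  show "br (br (m (nxt i) 1) X) X = 0"
    unfolding X using br_X[of "nxt i" 0] q_ge_3 by simp
  show "br (br (m (nxt i) 1) X) Y = - m i (q - 2)"
    unfolding X by (rule br_Y_0[OF assms(1)])
  show "br (br (m (nxt i) 1) Y) Y = 0"
    unfolding Y using H Y_in_H br_Y_ge_2[OF assms(1), of "q - 1"] q_ge_3
    by (simp add: bracket_scale_left)
  show "br (br (m (nxt i) 1) Y) X = dp_scale c (m i (q - 2))"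
    unfolding Y using H X_in_H br_X[OF assms(1), of "q - 1"] q_ge_3
    by (simp add: bracket_scale_left diff_diff_add numeral_2_eq_2)
qed

lemma diamond_type:
  assumes "d > 1" "N.diamond d"
  shows "N.has_type (monom X 1) (monom Y 1) d
    (if [d = q] (mod M) then Finite_Type (- 1) else Infinite_Type)"
proof -
  obtain i j where ij: "i < r" "0 < j" "j < q" and deg: "[deg i j = int d] (mod int M)"
    using degree_representative .
  have j: "j = q - 1"
    using dim_Nc_deg[OF _ ij deg] assms by (auto simp: N.diamond_def split: if_splits)
  let ?V = "m (nxt i) 1"
  have "[deg (nxt i) 0 - 1 = int d - 1] (mod int M)"
    using cong_trans[OF deg_nxt[OF ij(1)]] deg j by (intro cong_diff cong_refl) auto
  then have deg': "[deg (nxt i) 1 = int (d - 1)] (mod int M)"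
    using assms deg_Suc[of "nxt i" 0] by (simp add: of_nat_diff)
  have span: "Nc (d - 1) = T.span {monom ?V (d - 1)}"
  proof -
    have "1 < q" "1 \<noteq> q - 1"
      using q_ge_3 by linarith+
    then have "{b \<in> monomials. b \<in> comp (int (d - 1))} = {?V}"
      using monomials_in_comp_deg[of "nxt i" 1] comp_cong[OF deg'] by simp
    then show ?thesis
      using Nc_eq_span[of "d - 1"] assms by simp
  qed
  have "?V \<noteq> 0"
    by (auto simp: dp_monom_def fun_eq_iff)
  have VH: "?V \<in> H" using q_ge_3 by (simp add: H_closed)
  have brackets: "tensor_bracket br (tensor_bracket br (monom ?V (d - 1)) (monom A 1)) (monom B 1)
      = monom (br (br ?V A) B) (Suc d)" if "A \<in> H" "B \<in> H" for A B
    using that VH assms(1) by (simp add: tensor_bracket_monom br_closed)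
  \<comment> \<open>The exceptional coefficient occurs exactly at the diamonds spanned by \<open>x^(r - 1) y^(q - 1)\<close>
    and \<open>1\<close>, which have degree \<open>q\<close>.\<close>
  have deg_q: "[int d = int q] (mod int M) \<longleftrightarrow> Suc i = r"
  proof -
    have "deg (r - 1) (q - 1) = int q - int M"
      using q_ge_3 r_ge_3 by (simp add: deg_def M_def of_nat_diff algebra_simps)
    then have "[deg (r - 1) (q - 1) = int q] (mod int M)"
      by (simp add: cong_iff_dvd_diff)
    then have "[int d = int q] (mod int M) \<longleftrightarrow> [deg (r - 1) (q - 1) = deg i j] (mod int M)"
      using deg by (auto simp: cong_def)
    also have "\<dots> \<longleftrightarrow> r - 1 = i"
      using ij j q_ge_3 by (subst deg_cong_iff_pos) auto
    finally show ?thesis using ij by auto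
  qed
  show ?thesis
    unfolding N.has_type_def
  proof (intro conjI exI[of _ "monom ?V (d - 1)"])
    show "N.type_relation (monom X 1) (monom Y 1) (monom ?V (d - 1))
      (if [d = q] (mod M) then Finite_Type (- 1) else Infinite_Type)"
    proof (cases "Suc i = r")
      case True
      then have "[d = q] (mod M)" using deg_q by (simp add: cong_int_iff)
      then show ?thesis
        using True
        by (simp add: brackets X_in_H Y_in_H brackets_below_diamond[OF ij(1)] tensor_scale_monom
            del: One_nat_def)
    next
      case False
      then have "\<not> [d = q] (mod M)" using deg_q by (simp add: cong_int_iff)
      then show ?thesis
        using False
        by (simp add: brackets X_in_H Y_in_H brackets_below_diamond[OF ij(1)] minus_monom
            del: One_nat_def)
    qed
  qed (use assms span \<open>?V \<noteq> 0\<close> in \<open>auto simp: brackets X_in_H Y_in_H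
      brackets_below_diamond[OF ij(1)] simp del: One_nat_def\<close>)
qed

lemma type_generators_XY: "N.type_generators q (monom X 1) (monom Y 1)"
  unfolding N.type_generators_def
proof (intro conjI impI ballI)
  show "T.span {monom X 1, monom Y 1} = Nc 1"
    using module_hom.span_image[OF module_hom_monom, of 1 "{X, Y}"] by (simp add: Nc_eq comp_1)
next
  fix P
  assume q: "q > 3" and "P \<in> Nc 2"
  then obtain v where v: "v \<in> comp 2" "P = monom v 2"
    by (auto simp: Nc_eq)
  have "deg 0 (q - 2) = 2"
    using q by (simp add: deg_def of_nat_diff)
  moreover have "q - 2 \<noteq> q - 1"
    using q by linarith
  ultimately obtain a where "v = dp_scale a (m 0 (q - 2))"
    using comp_deg[of 0 "q - 2" v] v q r_ge_3 by auto
  then have "br v Y = 0"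
    using q r_ge_3 br_Y_ge_2[of 0 "q - 2"] by (simp add: bracket_scale_left Y_in_H H_closed)
  then show "tensor_bracket br P (monom Y 1) = 0"
    using v Y_in_comp by (simp add: bracket_Nc)
next
  fix P
  assume P: "P \<in> Nc (q - 1)" "P \<noteq> 0"
  then obtain v where v: "v \<in> comp (int (q - 1))" "P = monom v (q - 1)"
    using q_ge_3 by (auto simp: Nc_eq)
  have "deg 0 1 = int (q - 1)"
    using q_ge_3 by (simp add: deg_def of_nat_diff)
  moreover have "1 \<noteq> q - 1"
    using q_ge_3 by linarith
  ultimately obtain a where a: "v = dp_scale a (m 0 1)"
    using comp_deg[of 0 1 v] v q_ge_3 r_ge_3 by auto
  have nxt: "nxt (r - 1) = 0" "r - 1 < r" "Suc (r - 1) = r"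
    using r_ge_3 by (simp_all add: nxt_def)
  have m01: "m 0 1 \<in> H" using q_ge_3 r_ge_3 by (simp add: H_closed)
  have "br (br v A) B = dp_scale a (br (br (m 0 1) A) B)" if "A \<in> H" "B \<in> H" for A B
    using that m01 by (simp add: a bracket_scale_left br_closed)
  note * = this[OF X_in_H X_in_H] this[OF Y_in_H Y_in_H] this[OF X_in_H Y_in_H] this[OF Y_in_H X_in_H]
  have brs: "br (br v X) X = 0" "br (br v Y) Y = 0" "br (br v Y) X = dp_scale (- 2) (br (br v X) Y)"
    unfolding * using brackets_below_diamond[OF nxt(2)] nxt by (simp_all del: One_nat_def)
  have vH: "v \<in> H" using v comp_subset by blast
  show "tensor_bracket br (tensor_bracket br P (monom X 1)) (monom X 1) = 0"
    "tensor_bracket br (tensor_bracket br P (monom Y 1)) (monom Y 1) = 0"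
    "tensor_bracket br (tensor_bracket br P (monom Y 1)) (monom X 1) =
      tscale (- 2) (tensor_bracket br (tensor_bracket br P (monom X 1)) (monom Y 1))"
    using brs unfolding v(2)
    by (simp_all add: tensor_bracket_monom vH X_in_H Y_in_H br_closed tensor_scale_monom)
qed

lemma graded_basis_monomials:
  "cyclic_graded_lie_algebra.graded_basis dp_scale H comp monomials"
  unfolding cyclic_graded_lie_algebra.graded_basis_def[OF cyclic_graded_comp]
proof (intro conjI)
  show "monomials \<subseteq> (\<Union>k. comp k)"
    by (auto simp: monomials_def monom_in_comp_iff intro!: cong_refl)
qed (rule independent_monomials, rule span_monomials)

lemma generators_are_monomials: "X \<in> monomials" "Y \<in> monomials"
  using q_ge_3 r_ge_3 by (auto simp: monomials_def X_def Y_def)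

end

theorem theorem5p1:
  fixes p n\<^sub>1 n\<^sub>2 q r M :: nat
    and H :: "(nat \<Rightarrow> nat \<Rightarrow> 'a::field) set"
    and X Y :: "nat \<Rightarrow> nat \<Rightarrow> 'a"
    and br :: "(nat \<Rightarrow> nat \<Rightarrow> 'a) \<Rightarrow> (nat \<Rightarrow> nat \<Rightarrow> 'a) \<Rightarrow> nat \<Rightarrow> nat \<Rightarrow> 'a"
  assumes "CHAR('a) = p" and "odd p"
    and "n\<^sub>1 > 0" and "n\<^sub>2 > 0"
    and "q = p ^ n\<^sub>2" and "r = p ^ n\<^sub>1" and "M = (q - 1) * r"
    and "H = dp_carrier r q" and "br = hamiltonian_bracket r q"
    and "X = dp_monom 1 0" and "Y = dp_monom 0 (q - 1)"
  shows "lie_algebra dp_scale H br \<and> vector_space.dim dp_scale H = q * r \<and>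
    \<comment> \<open>(1)\<close>
    lie_algebra.generated dp_scale H br {X, Y} = H \<and>
    (\<exists>!C. cyclic_graded_lie_algebra dp_scale H br M C \<and> X \<in> C 1 \<and> Y \<in> C 1) \<and>
    (\<forall>C. cyclic_graded_lie_algebra dp_scale H br M C \<and> X \<in> C 1 \<and> Y \<in> C 1 \<longrightarrow>
      (let B = (\<lambda>(i, j). dp_monom i j) ` ({..<r} \<times> {..<q});
           sc = tensor_scale dp_scale;
           lbr = tensor_bracket br;
           N = loop_algebra dp_scale H br C;
           Nc = loop_component dp_scale H br C;
           X\<^sub>L = monom X 1;
           Y\<^sub>L = monom Y 1
       in
        \<comment> \<open>(2)\<close>
        inj_on (\<lambda>(i, j). dp_monom i j :: nat \<Rightarrow> nat \<Rightarrow> 'a) ({..<r} \<times> {..<q}) \<and>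
        cyclic_graded_lie_algebra.graded_basis dp_scale H C B \<and>
        X \<in> B \<and> Y \<in> B \<and>
        (\<forall>i<r. \<forall>j<q. dp_monom i j \<in> C ((1 - int q) * int i - int j + int q)) \<and>
        \<comment> \<open>(3)\<close>
        thin_lie_algebra sc N lbr Nc \<and>
        thin_lie_algebra.second_diamond sc Nc q \<and>
        \<comment> \<open>(4)\<close>
        (\<forall>i\<ge>1. thin_lie_algebra.diamond sc Nc i \<longleftrightarrow> [i = 1] (mod (q - 1))) \<and>
        thin_lie_algebra.type_generators sc lbr Nc q X\<^sub>L Y\<^sub>L \<and>
        (\<forall>i>1. thin_lie_algebra.diamond sc Nc i \<longrightarrow>
           thin_lie_algebra.has_type sc lbr Nc X\<^sub>L Y\<^sub>L i
             (if [i = q] (mod M) then Finite_Type (- 1) else Infinite_Type))))"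
proof -
  interpret hamiltonian p n\<^sub>1 n\<^sub>2 q r M H X Y br
    by (rule hamiltonian.intro) (use assms in auto)
  have unique: "C = comp"
    if "cyclic_graded_lie_algebra dp_scale H br M C \<and> X \<in> C 1 \<and> Y \<in> C 1" for C
    using that grading_unique by blast
  show ?thesis
  proof (intro conjI allI impI)
    show "lie_algebra dp_scale H br" by (rule lie_algebra_H)
    show "vector_space.dim dp_scale H = q * r" by (rule dim_H)
    show "lie_algebra.generated dp_scale H br {X, Y} = H" by (rule generated_XY)
    show "\<exists>!C. cyclic_graded_lie_algebra dp_scale H br M C \<and> X \<in> C 1 \<and> Y \<in> C 1"
      using cyclic_graded_comp X_in_comp Y_in_comp unique by blast
  next
    fix C
    assume "cyclic_graded_lie_algebra dp_scale H br M C \<and> X \<in> C 1 \<and> Y \<in> C 1"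
    then have C: "C = comp" by (rule unique)
    show "let B = (\<lambda>(i, j). dp_monom i j) ` ({..<r} \<times> {..<q});
           sc = tensor_scale dp_scale;
           lbr = tensor_bracket br;
           N = loop_algebra dp_scale H br C;
           Nc = loop_component dp_scale H br C;
           X\<^sub>L = monom X 1;
           Y\<^sub>L = monom Y 1
       in
        inj_on (\<lambda>(i, j). dp_monom i j :: nat \<Rightarrow> nat \<Rightarrow> 'a) ({..<r} \<times> {..<q}) \<and>
        cyclic_graded_lie_algebra.graded_basis dp_scale H C B \<and>
        X \<in> B \<and> Y \<in> B \<and>
        (\<forall>i<r. \<forall>j<q. dp_monom i j \<in> C ((1 - int q) * int i - int j + int q)) \<and>
        thin_lie_algebra sc N lbr Nc \<and>
        thin_lie_algebra.second_diamond sc Nc q \<and>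
        (\<forall>i\<ge>1. thin_lie_algebra.diamond sc Nc i \<longleftrightarrow> [i = 1] (mod (q - 1))) \<and>
        thin_lie_algebra.type_generators sc lbr Nc q X\<^sub>L Y\<^sub>L \<and>
        (\<forall>i>1. thin_lie_algebra.diamond sc Nc i \<longrightarrow>
           thin_lie_algebra.has_type sc lbr Nc X\<^sub>L Y\<^sub>L i
             (if [i = q] (mod M) then Finite_Type (- 1) else Infinite_Type))"
      unfolding Let_def C N_def[symmetric] Nc_def[symmetric] monomials_def[symmetric]
    proof (intro conjI allI impI)
      show "dp_monom i j \<in> comp ((1 - int q) * int i - int j + int q)" if "i < r" "j < q" for i j
        using that monom_in_comp_iff by (simp add: deg_def)
    qed (simp_all only: monomials_inj graded_basis_monomials generators_are_monomials thin_N
        second_diamond_q diamond_iff type_generators_XY diamond_type)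
  qed
qed

end
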